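(* Let $u_a,u_b,u_c:[0,T]\to\mathbb{R}$ be fixed measurable (and integrable) functions, and let $S_{\mathfrak{a}_1}\in\mathbb{R}\langle\langle \mathrm{A}\rangle\rangle$ be the unique solution (with zero constant term) of $S_{\mathfrak{a}_1}=b-a\,\exp_{\sqcup\!\sqcup}(2S_{\mathfrak{a}_1})\,c$. Then the function $\Xi_a(t)=\Upsilon^t\big(a\,\exp_{\sqcup\!\sqcup}(2S_{\mathfrak{a}_1})\big)$ is locally (i.e. for $t\in[0,\tau]$ for some $0<\tau\le T$) the solution of the Riccati equation $$\dot\Xi_a(t)=u_a(t)+2u_b(t)\,\Xi_a(t)-u_c(t)\,\Xi_a^2(t),\qquad \Xi_a(0)=0.$$
   Context: Let $\mathrm{A}=\{a,b,c\}$ be a set of three letters, $\mathrm{A}^*$ the set of all words in these letters (free monoid under concatenation, with empty word $1$), and $\mathbb{R}\langle\langle \mathrm{A}\rangle\rangle$ the algebra of non-commutative formal power series on $\mathrm{A}$; juxtaposition denotes the concatenation product. The shuffle product $\sqcup\!\sqcup$ on $\mathbb{R}\langle\langle \mathrm{A}\rangle\rangle$ is the bilinear commutative product defined on words by $1\sqcup\!\sqcup w=w\sqcup\!\sqcup 1=w$ and $(w_1a_1)\sqcup\!\sqcup(w_2a_2)=(w_1\sqcup\!\sqcup(w_2a_2))a_1+((w_1a_1)\sqcup\!\sqcup w_2)a_2$ for letters $a_1,a_2$ and words $w_1,w_2$. For a series $P$ with zero constant term, $\exp_{\sqcup\!\sqcup}(P):=1+\sum_{k\ge1}P^{\sqcup\!\sqcup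 k}/k!$, where $P^{\sqcup\!\sqcup k}$ is the $k$-th shuffle power. For the given functions, $\Upsilon^t$ is the linear map given by $\Upsilon^t(1)=1$ and, for a word $w=a_1\cdots a_n$ with letters $a_i\in \mathrm{A}$, $$\Upsilon^t(w)=\int_0^t u_{a_n}(t_n)\int_0^{t_n}\cdots\int_0^{t_2}u_{a_1}(t_1)\,dt_1\cdots dt_{n-1}\,dt_n,$$ extended to series by $\Upsilon^t(\sum_w c_w w)=\sum_w c_w\Upsilon^t(w)$ (the claim being local in $t$, it is for small $t$ that these sums are considered). Solutions are understood in the Carathéodory sense (absolutely continuous, equation satisfied almost everywhere). *)

theory Defs
  imports "HOL-Analysis.Analysis"
begin

datatype letter = A | B | C

text \<open>The series \<open>\<Sum>\<^sub>w c\<^sub>w w\<close> is represented by its coefficient function \<open>w \<mapsto> c\<^sub>w\<close>.\<close>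

type_synonym 'a series = "'a list \<Rightarrow> real"

definition of_word :: "'a list \<Rightarrow> 'a series" where
  "of_word v = (\<lambda>w. if w = v then 1 else 0)"

definition conc :: "'a series \<Rightarrow> 'a series \<Rightarrow> 'a series"  (infixr "\<cdot>" 70) where
  "P \<cdot> Q = (\<lambda>w. \<Sum>(u, v) | u @ v = w. P u * Q v)"

function shuffle_word :: "'a list \<Rightarrow> 'a list \<Rightarrow> 'a series" where
  "shuffle_word [] w = of_word w"
| "shuffle_word (w @ [x]) [] = of_word (w @ [x])"
| "shuffle_word (w1 @ [x1]) (w2 @ [x2]) =
     (\<lambda>w. (shuffle_word w1 (w2 @ [x2]) \<cdot> of_word [x1]) w
        + (shuffle_word (w1 @ [x1]) w2 \<cdot> of_word [x2]) w)"
proof goal_cases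
  case (1 P x)
  obtain u v where x: "x = (u, v)" by (cases x)
  show ?case
    using 1 by (cases u rule: rev_cases; cases v rule: rev_cases; simp add: x)
qed auto
termination by (relation "Wellfounded.measure (\<lambda>(u, v). length u + length v)") auto

text \<open>Bilinear extension to series; only finitely many pairs of words contribute to a given
  coefficient, see \<open>finite_shuffle_support\<close> below.\<close>

definition shuffle :: "'a series \<Rightarrow> 'a series \<Rightarrow> 'a series" where
  "shuffle P Q = (\<lambda>w. \<Sum>(u, v) | shuffle_word u v w \<noteq> 0. P u * Q v * shuffle_word u v w)"

fun shuffle_power :: "'a series \<Rightarrow> nat \<Rightarrow> 'a series" where
  "shuffle_power P 0 = of_word []"
| "shuffle_power P (Suc k) = shuffle P (shuffle_power P k)"

text \<open>If \<open>P\<close> has zero constant term, the sum over \<open>k\<close> is finite in each coefficient,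
  see \<open>shuffle_power_eq_0\<close> below.\<close>

definition shuffle_exp :: "'a series \<Rightarrow> 'a series" where
  "shuffle_exp P = (\<lambda>w. of_word [] w + (\<Sum>k. shuffle_power P (Suc k) w / fact (Suc k)))"

lemma shuffle_word_support:
  "shuffle_word u v w \<noteq> 0 \<Longrightarrow> length w = length u + length v \<and> set w = set u \<union> set v"
proof (induction u v arbitrary: w rule: shuffle_word.induct)
  case (3 w1 x1 w2 x2)
  have *: "\<exists>w'. w = w' @ [x] \<and> P w' \<noteq> 0" if nz: "(P \<cdot> of_word [x]) w \<noteq> 0" for P :: "'a series" and x
  proof -
    obtain p where "p \<in> {(u, v). u @ v = w}" "(case p of (u, v) \<Rightarrow> P u * of_word [x] v) \<noteq> 0"
      using nz unfolding conc_def by (rule sum.not_neutral_contains_not_neutral)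
    then show ?thesis by (cases p) (auto simp: of_word_def split: if_splits)
  qed
  consider
      "(shuffle_word w1 (w2 @ [x2]) \<cdot> of_word [x1]) w \<noteq> 0"
    | "(shuffle_word (w1 @ [x1]) w2 \<cdot> of_word [x2]) w \<noteq> 0"
    using "3.prems" by (simp only: shuffle_word.simps) linarith
  then show ?case
  proof cases
    case 1
    then obtain w' where "w = w' @ [x1]" "shuffle_word w1 (w2 @ [x2]) w' \<noteq> 0" using * by blast
    with "3.IH"(1)[of w'] show ?thesis by auto
  next
    case 2
    then obtain w' where "w = w' @ [x2]" "shuffle_word (w1 @ [x1]) w2 w' \<noteq> 0" using * by blast
    with "3.IH"(2)[of w'] show ?thesis by auto
  qed
qed (auto simp: of_word_def split: if_splits)

lemma finite_shuffle_support: "finite {(u, v). shuffle_word u v w \<noteq> 0}"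
proof (rule finite_subset)
  let ?W = "{xs. set xs \<subseteq> set w \<and> length xs \<le> length w}"
  show "{(u, v). shuffle_word u v w \<noteq> 0} \<subseteq> ?W \<times> ?W"
    by (auto dest: shuffle_word_support)
  show "finite (?W \<times> ?W)" by (simp add: finite_lists_length_le)
qed

lemma shuffle_power_eq_0: "P [] = 0 \<Longrightarrow> length w < k \<Longrightarrow> shuffle_power P k w = 0"
proof (induction k arbitrary: w)
  case (Suc k)
  have "P u * shuffle_power P k v * shuffle_word u v w = 0" if "shuffle_word u v w \<noteq> 0" for u v
  proof (cases "u = []")
    case False
    then have "length v < k"
      using shuffle_word_support[OF that] Suc.prems(2) by (cases u) auto
    with Suc.IH Suc.prems(1) show ?thesis by simp
  qed (use Suc.prems in simp)
  then show ?case by (auto simp: shuffle_def intro!: sum.neutral)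
qed simp

definition is_S_a1 :: "letter series \<Rightarrow> bool" where
  "is_S_a1 S \<longleftrightarrow> S [] = 0 \<and>
     S = (\<lambda>w. of_word [B] w - (of_word [A] \<cdot> shuffle_exp (\<lambda>v. 2 * S v) \<cdot> of_word [C]) w)"

definition S_a1 :: "letter series" where
  "S_a1 = (THE S. is_S_a1 S)"

definition X_a :: "letter series" where
  "X_a = of_word [A] \<cdot> shuffle_exp (\<lambda>w. 2 * S_a1 w)"

function upsilon_word :: "('a \<Rightarrow> real \<Rightarrow> real) \<Rightarrow> real \<Rightarrow> 'a list \<Rightarrow> real" where
  "upsilon_word u t [] = 1"
| "upsilon_word u t (w @ [x]) = (LINT s:{0..t}|lebesgue. u x s * upsilon_word u s w)"
proof goal_cases
  case (1 P x)
  obtain u t w where x: "x = (u, t, w)" by (cases x)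
  show ?case
    using 1 by (cases w rule: rev_cases; simp add: x)
qed auto
termination by (relation "Wellfounded.measure (\<lambda>(u, t, w). length w)") auto

definition upsilon_summable :: "('a \<Rightarrow> real \<Rightarrow> real) \<Rightarrow> real \<Rightarrow> 'a series \<Rightarrow> bool" where
  "upsilon_summable u t P \<longleftrightarrow> (\<lambda>w. P w * upsilon_word u t w) summable_on UNIV"

definition upsilon :: "('a \<Rightarrow> real \<Rightarrow> real) \<Rightarrow> real \<Rightarrow> 'a series \<Rightarrow> real" where
  "upsilon u t P = (\<Sum>\<^sub>\<infinity>w. P w * upsilon_word u t w)"

definition Xi_a :: "(letter \<Rightarrow> real \<Rightarrow> real) \<Rightarrow> real \<Rightarrow> real" where
  "Xi_a u t = upsilon u t X_a"

definition abs_continuous_on :: "real \<Rightarrow> real \<Rightarrow> (real \<Rightarrow> real) \<Rightarrow> bool" where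
  "abs_continuous_on p q f \<longleftrightarrow>
     (\<forall>\<epsilon>>0. \<exists>\<delta>>0. \<forall>(n::nat) l r.
        (\<forall>i<n. p \<le> l i \<and> l i \<le> r i \<and> r i \<le> q) \<longrightarrow>
        (\<forall>i<n. \<forall>j<n. i \<noteq> j \<longrightarrow> {l i<..<r i} \<inter> {l j<..<r j} = {}) \<longrightarrow>
        (\<Sum>i<n. r i - l i) < \<delta> \<longrightarrow> (\<Sum>i<n. \<bar>f (r i) - f (l i)\<bar>) < \<epsilon>)"

definition caratheodory_solution ::
  "(real \<Rightarrow> real \<Rightarrow> real) \<Rightarrow> real \<Rightarrow> real \<Rightarrow> (real \<Rightarrow> real) \<Rightarrow> bool" where
  "caratheodory_solution F y0 \<tau> y \<longleftrightarrow>
     abs_continuous_on 0 \<tau> y \<and> y 0 = y0 \<and>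
     (AE t in lebesgue. t \<in> {0..\<tau>} \<longrightarrow>
        (y has_real_derivative F t (y t)) (at t within {0..\<tau>}))"

end

(* Write D_x P for the series w |-> P(w x).  Since the shuffle product is defined by recursion on the
   last letter, every D_x is a derivation, so exp(2S) satisfies D_x exp(2S) = 2 (D_x S) shuffled with
   exp(2S).  For X = a exp(2S) this gives D_a X = 1, D_b X = 2X, D_c X = -(X shuffle X); the last one
   uses that removing the first letter is a derivation as well.  As iterated integrals turn shuffles
   into products (integration by parts) and the last letter into differentiation, the Riccati
   equation follows once the series converges.  Its homogeneous parts are dominated by those for
   |u_x| and |X|, whose partial sums y satisfy the recursive estimate
   y_(n+1) <= integral of |u_a| + 2 |u_b| y_n + |u_c| y_n^2, and hence stay below 1 for small t.
   Uniqueness: the difference z of two solutions satisfies a linear equation z' = h z, so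
   exp(-H) z, with H a primitive of h, is absolutely continuous with derivative 0 almost
   everywhere. *)

theory Submission
  imports Defs
begin

section \<open>Shuffle algebra\<close>

text \<open>The inputs are merely integrable, so iterated integrals are differentiable only almost
  everywhere and the fundamental theorem for continuous integrands is of no use. Every comparison of
  two functions of time instead rests on one principle: absolutely continuous functions with the
  same derivative almost everywhere and the same initial value agree. This is also how shuffles
  become products. Infinite sums are kept out of the algebra. The alphabet is finite, so the part of
  a series of fixed word length evaluates to a finite sum, and all identities are proved degree by
  degree. Limits enter only at the end, under an integral sign: almost-everywhere derivatives need
  not converge along with the partial sums, but integrals do by dominated convergence. The Riccati
  equation is therefore first obtained in integral form. The bound 1 is a normalisation: a level M
  is preserved once the integral of |u_a| + 2 |u_b| M + |u_c| M^2 is at most M, and M = 1 gives the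
  simplest such condition.\<close>

definition right_deriv :: "'a \<Rightarrow> 'a series \<Rightarrow> 'a series" where
  "right_deriv x P = (\<lambda>w. P (w @ [x]))"

definition left_deriv :: "'a \<Rightarrow> 'a series \<Rightarrow> 'a series" where
  "left_deriv x P = (\<lambda>w. P (x # w))"

lemma conc_letter_Nil: "(P \<cdot> of_word [x]) [] = 0" "(of_word [x] \<cdot> P) [] = 0"
  by (auto simp: conc_def of_word_def intro!: sum.neutral)

lemma finite_splits: "finite {(u, v). u @ v = w}"
proof (rule finite_subset)
  show "{(u, v). u @ v = w} \<subseteq> {xs. set xs \<subseteq> set w \<and> length xs \<le> length w} \<times>
      {xs. set xs \<subseteq> set w \<and> length xs \<le> length w}" by auto
qed (simp add: finite_lists_length_le)

lemma conc_letter_snoc: "(P \<cdot> of_word [x]) (w @ [y]) = (if y = x then P w else 0)"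
proof -
  have "(P \<cdot> of_word [x]) (w @ [y]) = (\<Sum>z\<in>{(u, v). u @ v = w @ [y]}. if z = (w, [y]) then if y = x then P w else 0 else 0)"
    unfolding conc_def by (rule sum.cong) (auto simp: of_word_def split: if_splits)
  then show ?thesis using finite_splits[of "w @ [y]"] by simp
qed

lemma letter_conc_Cons: "(of_word [x] \<cdot> P) (y # w) = (if y = x then P w else 0)"
proof -
  have "(of_word [x] \<cdot> P) (y # w) = (\<Sum>z\<in>{(u, v). u @ v = y # w}. if z = ([y], w) then if y = x then P w else 0 else 0)"
    unfolding conc_def by (rule sum.cong) (auto simp: of_word_def split: if_splits)
  then show ?thesis using finite_splits[of "y # w"] by simp
qed

lemma of_word_snoc:
  "of_word [] (w @ [x]) = 0"
  "of_word (v @ [y]) (w @ [x]) = (if x = y then of_word v w else 0)"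
  "of_word [y] (w @ [x]) = (if x = y then of_word [] w else 0)"
  by (auto simp: of_word_def)

lemma shuffle_word_Nil_right: "shuffle_word w [] = of_word w"
  by (cases w rule: rev_cases) simp_all

text \<open>The last letter of a word in the shuffle comes from \<open>u\<close> or from
  \<open>v\<close>. The guards make the empty words fit the same formula, so later proofs avoid the
  case split of the definition.\<close>

lemma shuffle_word_snoc:
  "shuffle_word u v (w @ [x]) =
     (if u \<noteq> [] \<and> last u = x then shuffle_word (butlast u) v w else 0) +
     (if v \<noteq> [] \<and> last v = x then shuffle_word u (butlast v) w else 0)"
proof (cases u rule: rev_cases)
  case Nil
  then show ?thesis
    by (cases v rule: rev_cases) (simp_all add: of_word_snoc)
next
  case u: (snoc u' y)
  then show ?thesis
    by (cases v rule: rev_cases)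
       (simp_all add: of_word_snoc conc_letter_snoc shuffle_word_Nil_right del: shuffle_word.simps(2))
qed

text \<open>The index set in \<open>shuffle\<close> varies with \<open>w\<close>; comparing
  coefficients at different words requires a common one.\<close>

lemma shuffle_superset:
  assumes "finite K" "{(u, v). shuffle_word u v w \<noteq> 0} \<subseteq> K"
  shows "shuffle P Q w = (\<Sum>(u, v)\<in>K. P u * Q v * shuffle_word u v w)"
  unfolding shuffle_def by (rule sum.mono_neutral_left[OF assms]) auto

lemma shuffle_Nil: "shuffle P Q [] = P [] * Q []"
proof -
  have "{(u, v). shuffle_word u v [] \<noteq> 0} \<subseteq> {([], [])}"
    by (auto dest: shuffle_word_support)
  then show ?thesis
    using shuffle_superset[of "{([], [])}" "[]" P Q] by (simp add: of_word_def)
qed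

text \<open>Reindexing by appending \<open>x\<close>. The two membership conditions keep the support
  of \<open>h\<close>, before and after appending, inside \<open>L\<close>, so no term is lost. In
  use, \<open>h\<close> is a coefficient of \<open>shuffle_word\<close> with one argument
  fixed.\<close>

lemma sum_butlast:
  fixes P h :: "'a list \<Rightarrow> real"
  assumes "finite L" "\<And>u. h u \<noteq> 0 \<Longrightarrow> u \<in> L" "\<And>u. h u \<noteq> 0 \<Longrightarrow> u @ [x] \<in> L"
  shows "(\<Sum>u\<in>L. if u \<noteq> [] \<and> last u = x then P u * h (butlast u) else 0) = (\<Sum>u\<in>L. P (u @ [x]) * h u)"
proof -
  have "(\<Sum>u\<in>L. if u \<noteq> [] \<and> last u = x then P u * h (butlast u) else 0)
      = (\<Sum>u\<in>(\<lambda>u. u @ [x]) ` {u\<in>L. h u \<noteq> 0}. P u * h (butlast u))"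
  proof (rule sum.mono_neutral_cong_right[OF \<open>finite L\<close>])
    have "u \<in> (\<lambda>u. u @ [x]) ` {u\<in>L. h u \<noteq> 0}" if "u \<noteq> []" "last u = x" "h (butlast u) \<noteq> 0" for u
      by (rule image_eqI[of _ _ "butlast u"]) (use that assms(2) in auto)
    then show "\<forall>u\<in>L - (\<lambda>u. u @ [x]) ` {u\<in>L. h u \<noteq> 0}.
        (if u \<noteq> [] \<and> last u = x then P u * h (butlast u) else 0) = 0"
      by auto
  qed (use assms(3) in auto)
  also have "\<dots> = (\<Sum>u | u \<in> L \<and> h u \<noteq> 0. P (u @ [x]) * h u)"
    by (subst sum.reindex) (auto simp: inj_on_def)
  also have "\<dots> = (\<Sum>u\<in>L. P (u @ [x]) * h u)"
    by (rule sum.mono_neutral_left[OF \<open>finite L\<close>]) auto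
  finally show ?thesis .
qed

lemma shuffle_snoc:
  "shuffle P Q (w @ [x]) = shuffle (right_deriv x P) Q w + shuffle P (right_deriv x Q) w"
proof -
  \<comment> \<open>One finite set serves the coefficients at \<open>w\<close> and at
    \<open>w @ [x]\<close>; a word occurring at \<open>w\<close> stays in it after \<open>x\<close>
    is appended.\<close>
  define L where "L = {xs. set xs \<subseteq> set (w @ [x]) \<and> length xs \<le> Suc (length w)}"
  have finL: "finite L" by (simp add: L_def finite_lists_length_le)
  then have fin: "finite (L \<times> L)" by simp
  have sup: "(u, v) \<in> L \<times> L" if "shuffle_word u v w \<noteq> 0 \<or> shuffle_word u v (w @ [x]) \<noteq> 0" for u v
    using that by (auto dest!: shuffle_word_support simp: L_def)
  have sup': "u @ [x] \<in> L" "v @ [x] \<in> L" if "shuffle_word u v w \<noteq> 0" for u v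
    using that by (auto dest!: shuffle_word_support simp: L_def)
  have "shuffle P Q (w @ [x]) = (\<Sum>(u, v)\<in>L \<times> L. P u * Q v * shuffle_word u v (w @ [x]))"
    by (rule shuffle_superset[OF fin]) (use sup in blast)
  also have "\<dots> = (\<Sum>u\<in>L. \<Sum>v\<in>L. P u * Q v * shuffle_word u v (w @ [x]))"
    by (simp add: sum.cartesian_product)
  also have "\<dots> = (\<Sum>u\<in>L. \<Sum>v\<in>L. Q v * (if u \<noteq> [] \<and> last u = x then P u * shuffle_word (butlast u) v w else 0))
      + (\<Sum>u\<in>L. \<Sum>v\<in>L. P u * (if v \<noteq> [] \<and> last v = x then Q v * shuffle_word u (butlast v) w else 0))"
    unfolding sum.distrib[symmetric]
    by (intro sum.cong refl) (simp add: shuffle_word_snoc distrib_left)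
  also have "\<dots> = (\<Sum>v\<in>L. Q v * (\<Sum>u\<in>L. if u \<noteq> [] \<and> last u = x then P u * shuffle_word (butlast u) v w else 0))
      + (\<Sum>u\<in>L. P u * (\<Sum>v\<in>L. if v \<noteq> [] \<and> last v = x then Q v * shuffle_word u (butlast v) w else 0))"
    unfolding sum_distrib_left by (intro arg_cong2[of _ _ _ _ "(+)"] sum.swap refl)
  also have "(\<Sum>v\<in>L. Q v * (\<Sum>u\<in>L. if u \<noteq> [] \<and> last u = x then P u * shuffle_word (butlast u) v w else 0))
      = (\<Sum>v\<in>L. Q v * (\<Sum>u\<in>L. P (u @ [x]) * shuffle_word u v w))"
    by (intro sum.cong arg_cong2[of _ _ _ _ times] sum_butlast refl) (use finL sup sup' in auto)
  also have "\<dots> = (\<Sum>u\<in>L. \<Sum>v\<in>L. right_deriv x P u * Q v * shuffle_word u v w)"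
    unfolding sum_distrib_left right_deriv_def by (subst sum.swap) (simp add: mult_ac)
  also have "\<dots> = shuffle (right_deriv x P) Q w"
    unfolding sum.cartesian_product by (rule shuffle_superset[OF fin, symmetric]) (use sup in blast)
  also have "(\<Sum>u\<in>L. P u * (\<Sum>v\<in>L. if v \<noteq> [] \<and> last v = x then Q v * shuffle_word u (butlast v) w else 0))
      = (\<Sum>u\<in>L. P u * (\<Sum>v\<in>L. Q (v @ [x]) * shuffle_word u v w))"
    by (intro sum.cong arg_cong2[of _ _ _ _ times] sum_butlast refl) (use finL sup sup' in auto)
  also have "\<dots> = (\<Sum>u\<in>L. \<Sum>v\<in>L. P u * right_deriv x Q v * shuffle_word u v w)"
    unfolding sum_distrib_left right_deriv_def by (simp add: mult_ac)
  also have "\<dots> = shuffle P (right_deriv x Q) w"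
    unfolding sum.cartesian_product by (rule shuffle_superset[OF fin, symmetric]) (use sup in blast)
  finally show ?thesis .
qed

lemma right_deriv_shuffle:
  "right_deriv x (shuffle P Q) = (\<lambda>w. shuffle (right_deriv x P) Q w + shuffle P (right_deriv x Q) w)"
  by (simp add: right_deriv_def[of x "shuffle P Q"] shuffle_snoc)

lemma shuffle_cong:
  assumes "\<And>v. length v \<le> length w \<Longrightarrow> P v = P' v" "\<And>v. length v \<le> length w \<Longrightarrow> Q v = Q' v"
  shows "shuffle P Q w = shuffle P' Q' w"
  unfolding shuffle_def
  by (rule sum.cong) (use assms in \<open>auto dest!: shuffle_word_support\<close>)

lemma shuffle_add_left: "shuffle (\<lambda>w. P w + Q w) R w = shuffle P R w + shuffle Q R w"
  by (simp add: shuffle_def case_prod_unfold algebra_simps sum.distrib)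

lemma shuffle_add_right: "shuffle P (\<lambda>w. Q w + R w) w = shuffle P Q w + shuffle P R w"
  by (simp add: shuffle_def case_prod_unfold algebra_simps sum.distrib)

lemma shuffle_cmult_left: "shuffle (\<lambda>w. c * P w) Q w = c * shuffle P Q w"
  by (simp add: shuffle_def case_prod_unfold algebra_simps sum_distrib_left)

lemma shuffle_cmult_right: "shuffle P (\<lambda>w. c * Q w) w = c * shuffle P Q w"
  by (simp add: shuffle_def case_prod_unfold algebra_simps sum_distrib_left)

lemma shuffle_zero_left: "shuffle (\<lambda>_. 0) Q w = 0"
  by (simp add: shuffle_def case_prod_unfold)

lemma shuffle_zero_right: "shuffle P (\<lambda>_. 0) w = 0"
  by (simp add: shuffle_def case_prod_unfold)

lemma shuffle_sum_right:
  "finite I \<Longrightarrow> shuffle P (\<lambda>w. \<Sum>i\<in>I. Q i w) w = (\<Sum>i\<in>I. shuffle P (Q i) w)"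
  by (induction I rule: finite_induct) (simp_all add: shuffle_zero_right shuffle_add_right)

text \<open>A series is determined by its constant term and its right derivatives, so identities
  follow by induction from the right. The derivation rule replaces a factor by its derivative, hence
  the series have to be arbitrary in the induction.\<close>

lemma shuffle_commute: "shuffle P Q w = shuffle Q P w"
  by (induction w arbitrary: P Q rule: rev_induct) (simp_all add: shuffle_Nil shuffle_snoc)

lemma shuffle_assoc: "shuffle (shuffle P Q) R w = shuffle P (shuffle Q R) w"
  by (induction w arbitrary: P Q R rule: rev_induct)
     (simp_all add: shuffle_Nil shuffle_snoc right_deriv_shuffle shuffle_add_left shuffle_add_right)

lemma shuffle_left_commute: "shuffle P (shuffle Q R) w = shuffle Q (shuffle P R) w"
proof -
  have "shuffle P Q = shuffle Q P" by (rule ext) (rule shuffle_commute)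
  then show ?thesis by (simp only: shuffle_assoc[symmetric])
qed

lemma shuffle_one_left: "shuffle (of_word []) P w = P w"
proof (induction w arbitrary: P rule: rev_induct)
  case (snoc x w)
  have "right_deriv x (of_word []) = (\<lambda>_. 0)" by (simp add: right_deriv_def of_word_def)
  with snoc show ?case by (simp add: shuffle_snoc shuffle_zero_left) (simp add: right_deriv_def)
qed (simp add: shuffle_Nil of_word_def)

text \<open>Removing the first letter commutes with removing the last, so the derivation rule passes
  from one end to the other by induction at the right end. In the base case the word has one letter
  and both removals coincide.\<close>

lemma shuffle_Cons:
  "shuffle P Q (x # w) = shuffle (left_deriv x P) Q w + shuffle P (left_deriv x Q) w"
proof (induction w arbitrary: P Q rule: rev_induct)
  case Nil
  show ?case
    using shuffle_snoc[of P Q "[]" x]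
    by (simp add: shuffle_Nil) (simp add: right_deriv_def left_deriv_def)
next
  case (snoc y w)
  have swap: "left_deriv x (right_deriv y P) = right_deriv y (left_deriv x P)" for P
    by (simp add: left_deriv_def right_deriv_def)
  show ?case
    using shuffle_snoc[of P Q "x # w" y] by (simp add: snoc swap shuffle_snoc)
qed

lemma shuffle_word_nonneg: "0 \<le> shuffle_word u v w"
proof (induction w arbitrary: u v rule: rev_induct)
  case Nil
  show ?case
  proof (cases "shuffle_word u v [] = 0")
    case False
    then have "u = []" "v = []" using shuffle_word_support by fastforce+
    then show ?thesis by (simp add: of_word_def)
  qed simp
qed (simp add: shuffle_word_snoc)

lemma abs_shuffle_le: "\<bar>shuffle P Q w\<bar> \<le> shuffle (\<lambda>w. \<bar>P w\<bar>) (\<lambda>w. \<bar>Q w\<bar>) w"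
  unfolding shuffle_def case_prod_unfold
  by (rule order_trans[OF sum_abs]) (simp add: abs_mult shuffle_word_nonneg)

section \<open>The shuffle exponential and its derivatives\<close>

lemma shuffle_exp_eq:
  assumes "P [] = 0" "length w \<le> n"
  shows "shuffle_exp P w = (\<Sum>k\<le>n. shuffle_power P k w / fact k)"
proof -
  have "(\<Sum>k. shuffle_power P (Suc k) w / fact (Suc k)) = (\<Sum>k<n. shuffle_power P (Suc k) w / fact (Suc k))"
    by (rule suminf_finite) (use assms in \<open>auto simp del: shuffle_power.simps simp: shuffle_power_eq_0\<close>)
  moreover have "{..n} = {..<Suc n}" by auto
  ultimately show ?thesis
    unfolding shuffle_exp_def by (simp only: sum.lessThan_Suc_shift) (simp del: shuffle_power.simps(2))
qed

text \<open>The derivative may fall on any of the \<open>Suc k\<close> factors; commutativity brings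
  the derived factor to the front, so all contributions are equal.\<close>

lemma right_deriv_shuffle_power:
  "right_deriv x (shuffle_power P (Suc k)) w = real (Suc k) * shuffle (right_deriv x P) (shuffle_power P k) w"
proof (induction k arbitrary: w)
  case 0
  have "right_deriv x (of_word []) = (\<lambda>_. 0)" by (simp add: right_deriv_def of_word_def)
  then show ?case by (simp add: right_deriv_shuffle shuffle_zero_right)
next
  case (Suc k)
  have "shuffle P (right_deriv x (shuffle_power P (Suc k))) w
      = real (Suc k) * shuffle P (shuffle (right_deriv x P) (shuffle_power P k)) w"
    unfolding Suc.IH[abs_def] shuffle_cmult_right by simp
  also have "shuffle P (shuffle (right_deriv x P) (shuffle_power P k)) w
      = shuffle (right_deriv x P) (shuffle P (shuffle_power P k)) w"
    by (rule shuffle_left_commute)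
  finally show ?case
    by (subst shuffle_power.simps) (simp add: right_deriv_shuffle algebra_simps)
qed

lemma right_deriv_shuffle_exp:
  assumes "P [] = 0"
  shows "right_deriv x (shuffle_exp P) w = shuffle (right_deriv x P) (shuffle_exp P) w"
proof -
  let ?n = "length w"
  have "right_deriv x (shuffle_exp P) w = (\<Sum>k\<le>Suc ?n. shuffle_power P k (w @ [x]) / fact k)"
    unfolding right_deriv_def by (rule shuffle_exp_eq) (use assms in auto)
  \<comment> \<open>The term k = 0 vanishes on a nonempty word. After the shift, the factor from the
    power rule turns \<open>fact (Suc k)\<close> into \<open>fact k\<close>.\<close>
  also have "\<dots> = (\<Sum>k\<le>?n. right_deriv x (shuffle_power P (Suc k)) w / fact (Suc k))"
    by (subst sum.atMost_Suc_shift) (simp add: right_deriv_def of_word_def del: shuffle_power.simps(2))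
  also have "\<dots> = (\<Sum>k\<le>?n. shuffle (right_deriv x P) (\<lambda>w. (1 / fact k) * shuffle_power P k w) w)"
    unfolding right_deriv_shuffle_power shuffle_cmult_right by (simp add: field_simps del: of_nat_Suc)
  also have "\<dots> = shuffle (right_deriv x P) (\<lambda>w. \<Sum>k\<le>?n. (1 / fact k) * shuffle_power P k w) w"
    by (rule shuffle_sum_right[symmetric]) simp
  \<comment> \<open>At \<open>w\<close> only coefficients of words up to length \<open>?n\<close>
    matter, and there the truncated exponential is exact.\<close>
  also have "\<dots> = shuffle (right_deriv x P) (shuffle_exp P) w"
    by (rule shuffle_cong) (use assms in \<open>simp_all add: shuffle_exp_eq[where n = ?n]\<close>)
  finally show ?thesis .
qed

lemma shuffle_power_cong:
  assumes "\<And>v. length v \<le> length w \<Longrightarrow> P v = Q v"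
  shows "shuffle_power P k w = shuffle_power Q k w"
  using assms by (induction k arbitrary: w) (auto intro!: shuffle_cong)

lemma shuffle_exp_cong:
  assumes "\<And>v. length v \<le> length w \<Longrightarrow> P v = Q v"
  shows "shuffle_exp P w = shuffle_exp Q w"
proof -
  have "shuffle_power P k w = shuffle_power Q k w" for k
    by (rule shuffle_power_cong) (rule assms)
  then show ?thesis by (simp only: shuffle_exp_def)
qed

section \<open>The equation for \<open>S_a1\<close> and the letter derivatives of
  \<open>X_a\<close>\<close>

lemma series_fixed_point:
  fixes \<Phi> :: "'a series \<Rightarrow> 'a series"
  assumes "\<And>P Q w. (\<And>v. length v < length w \<Longrightarrow> P v = Q v) \<Longrightarrow> \<Phi> P w = \<Phi> Q w"
  shows "\<exists>!S. S = \<Phi> S"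
proof (rule ex_ex1I)
  \<comment> \<open>Each coefficient is computed from those of shorter words, so well-founded
    recursion on the length produces the fixed point.\<close>
  have "adm_wf (Wellfounded.measure length) \<Phi>"
    unfolding adm_wf_def by (intro allI impI assms) simp
  from wfrec_fixpoint[OF wf_measure this] show "\<exists>S. S = \<Phi> S" by (intro exI)
next
  fix S S' assume S: "S = \<Phi> S" "S' = \<Phi> S'"
  have "S w = S' w" for w
  proof (induction w rule: length_induct)
    case (1 w)
    have "S w = \<Phi> S w" by (rule fun_cong[OF S(1)])
    also have "\<dots> = \<Phi> S' w" by (rule assms) (use 1 in auto)
    also have "\<dots> = S' w" by (rule fun_cong[OF S(2), symmetric])
    finally show ?case .
  qed
  then show "S = S'" by blast
qed

lemma ex1_S_a1: "\<exists>!S. is_S_a1 S"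
proof -
  define \<Phi> :: "letter series \<Rightarrow> letter series" where "\<Phi> = (\<lambda>S w. of_word [B] w - (of_word [A] \<cdot> shuffle_exp (\<lambda>v. 2 * S v) \<cdot> of_word [C]) w)"
  have "\<exists>!S. S = \<Phi> S"
  proof (rule series_fixed_point)
    fix P Q :: "letter series" and w :: "letter list"
    assume eq: "\<And>v. length v < length w \<Longrightarrow> P v = Q v"
    \<comment> \<open>The product sees the exponential only at \<open>w\<close> stripped of its
      first and last letter, and the exponential there involves no longer words.\<close>
    have "(of_word [A] \<cdot> shuffle_exp (\<lambda>v. 2 * P v) \<cdot> of_word [C]) w
        = (of_word [A] \<cdot> shuffle_exp (\<lambda>v. 2 * Q v) \<cdot> of_word [C]) w"
    proof (cases w)
      case (Cons y w')
      then show ?thesis using eq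
        by (cases w' rule: rev_cases)
           (simp_all add: letter_conc_Cons conc_letter_snoc conc_letter_Nil cong: shuffle_exp_cong)
    qed (simp add: conc_letter_Nil)
    then show "\<Phi> P w = \<Phi> Q w" by (simp add: \<Phi>_def)
  qed
  moreover have "is_S_a1 S \<longleftrightarrow> S = \<Phi> S" for S
  proof -
    have "of_word [B] [] = 0" by (simp add: of_word_def)
    then have "\<Phi> S [] = 0" by (simp add: \<Phi>_def conc_letter_Nil)
    moreover have "is_S_a1 S \<longleftrightarrow> S [] = 0 \<and> S = \<Phi> S"
      by (simp only: is_S_a1_def \<Phi>_def)
    moreover have "S [] = 0" if "S = \<Phi> S"
      using fun_cong[OF that, of "[]"] \<open>\<Phi> S [] = 0\<close> by simp
    ultimately show ?thesis by blast
  qed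
  ultimately show ?thesis by simp
qed

lemma is_S_a1_S_a1: "is_S_a1 S_a1"
  unfolding S_a1_def using ex1_S_a1 by (rule theI')

lemma X_a_Nil: "X_a [] = 0"
  by (simp add: X_a_def conc_letter_Nil)

lemma left_deriv_X_a: "left_deriv y X_a = (if y = A then shuffle_exp (\<lambda>w. 2 * S_a1 w) else (\<lambda>_. 0))"
  by (auto simp: left_deriv_def X_a_def letter_conc_Cons)

text \<open>Regrouping a (exp c) as (a exp) c turns the defining equation into S = b - X c. Since
  \<open>\<cdot>\<close> associates to the right, the regrouping is done on coefficients, by
  splitting the word at both ends.\<close>

lemma right_deriv_S_a1:
  "right_deriv A S_a1 = (\<lambda>_. 0)"
  "right_deriv B S_a1 = of_word []"
  "right_deriv C S_a1 = (\<lambda>w. - X_a w)"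
proof -
  have S: "S_a1 w = of_word [B] w - (of_word [A] \<cdot> shuffle_exp (\<lambda>v. 2 * S_a1 v) \<cdot> of_word [C]) w" for w
    using is_S_a1_S_a1 unfolding is_S_a1_def by metis
  have X: "X_a w = (case w of [] \<Rightarrow> 0 | y # v \<Rightarrow> if y = A then shuffle_exp (\<lambda>v. 2 * S_a1 v) v else 0)" for w
    unfolding X_a_def by (cases w) (simp_all add: conc_letter_Nil letter_conc_Cons)
  have letter: "of_word [B] (w @ [x]) = (if x = B then of_word [] w else 0)" for w x
    by (simp add: of_word_def)
  have "S_a1 (w @ [x]) = (if x = B then of_word [] w else 0) - (if x = C then X_a w else 0)" for w x
    unfolding S[of "w @ [x]"] X letter
    by (cases w) (auto simp: letter_conc_Cons conc_letter_snoc conc_letter_Nil letter)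
  then show "right_deriv A S_a1 = (\<lambda>_. 0)" "right_deriv B S_a1 = of_word []"
     "right_deriv C S_a1 = (\<lambda>w. - X_a w)"
    by (auto simp: right_deriv_def)
qed

lemma right_deriv_X_a:
  "right_deriv A X_a = of_word []"
  "right_deriv B X_a = (\<lambda>w. 2 * X_a w)"
  "right_deriv C X_a = (\<lambda>w. - shuffle X_a X_a w)"
proof -
  define E where "E = shuffle_exp (\<lambda>w. 2 * S_a1 w)"
  have S0: "2 * S_a1 [] = 0" using is_S_a1_S_a1 by (simp add: is_S_a1_def)
  have E: "right_deriv x E w = 2 * shuffle (right_deriv x S_a1) E w" for x w
    using right_deriv_shuffle_exp[of "\<lambda>w. 2 * S_a1 w", OF S0, of x w]
    by (simp add: E_def right_deriv_def shuffle_cmult_left)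
  have E0: "E [] = 1"
    unfolding E_def using shuffle_exp_eq[of "\<lambda>w. 2 * S_a1 w", OF S0, of "[]" 0] by (simp add: of_word_def)
  have X: "X_a (y # w) = (if y = A then E w else 0)" for y w
    by (simp add: X_a_def letter_conc_Cons E_def)
  \<comment> \<open>On a one-letter word the first and last letter coincide, and the constant term
    of \<open>E\<close> appears; it is the source of the forcing term of the Riccati
    equation.\<close>
  have D: "right_deriv x X_a w = (case w of [] \<Rightarrow> if x = A then 1 else 0
      | y # v \<Rightarrow> if y = A then right_deriv x E v else 0)" for x w
    by (cases w) (simp_all add: right_deriv_def X E0)
  show "right_deriv A X_a = of_word []"
    by (rule ext, subst D) (auto simp: E right_deriv_S_a1 shuffle_zero_left of_word_def split: list.split)
  show "right_deriv B X_a = (\<lambda>w. 2 * X_a w)"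
    by (rule ext, subst D) (auto simp: E right_deriv_S_a1 shuffle_one_left X X_a_Nil split: list.split)
  \<comment> \<open>All words of the shuffle square begin with \<open>A\<close>, and removing it
    leaves two equal summands. This 2 matches the 2 in the exponent of \<open>E\<close>, which is
    why the derivative by \<open>C\<close> is exactly minus the square.\<close>
  have "shuffle X_a X_a (y # w) = (if y = A then 2 * shuffle X_a E w else 0)" for y w
    using shuffle_commute[of E X_a w]
    by (simp add: shuffle_Cons left_deriv_X_a shuffle_zero_left shuffle_zero_right flip: E_def)
  moreover have "shuffle (\<lambda>w. - X_a w) E w = - shuffle X_a E w" for w
    using shuffle_cmult_left[of "-1" X_a E w] by simp
  ultimately show "right_deriv C X_a = (\<lambda>w. - shuffle X_a X_a w)"
    by (intro ext, subst D) (auto simp: E right_deriv_S_a1 shuffle_Nil X_a_Nil split: list.split)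
qed

section \<open>Absolutely continuous functions\<close>

definition disj_intervals :: "real \<Rightarrow> real \<Rightarrow> 'i set \<Rightarrow> ('i \<Rightarrow> real) \<Rightarrow> ('i \<Rightarrow> real) \<Rightarrow> bool" where
  "disj_intervals p q I l r \<longleftrightarrow> finite I \<and> (\<forall>i\<in>I. p \<le> l i \<and> l i \<le> r i \<and> r i \<le> q) \<and>
     disjoint_family_on (\<lambda>i. {l i<..<r i}) I"

text \<open>The definition speaks of families numbered by naturals, while tagged divisions are
  indexed by pairs of a tag and an interval. Numbering the finite index set bridges the two.\<close>

lemma abs_continuous_on_finite:
  assumes "abs_continuous_on p q f" "e > 0"
  obtains d where "d > 0" "\<And>(I :: 'i set) l r. disj_intervals p q I l r \<Longrightarrow>
     (\<Sum>i\<in>I. r i - l i) < d \<Longrightarrow> (\<Sum>i\<in>I. \<bar>f (r i) - f (l i)\<bar>) < e"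
proof -
  obtain d where "d > 0" and d: "\<And>(n::nat) l r.
      \<lbrakk>\<forall>i<n. p \<le> l i \<and> l i \<le> r i \<and> r i \<le> q;
       \<forall>i<n. \<forall>j<n. i \<noteq> j \<longrightarrow> {l i<..<r i} \<inter> {l j<..<r j} = {};
       (\<Sum>i<n. r i - l i) < d\<rbrakk> \<Longrightarrow> (\<Sum>i<n. \<bar>f (r i) - f (l i)\<bar>) < e"
    using assms(1)[unfolded abs_continuous_on_def, rule_format, OF \<open>e > 0\<close>] by blast
  show thesis
  proof (rule that[OF \<open>d > 0\<close>])
    fix I :: "'i set" and l r
    assume I: "disj_intervals p q I l r" and len: "(\<Sum>i\<in>I. r i - l i) < d"
    then have "finite I" by (simp add: disj_intervals_def)
    then obtain h where h: "bij_betw h {0..<card I} I"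
      using ex_bij_betw_nat_finite by blast
    then have h': "bij_betw h {..<card I} I" by (simp add: atLeast0LessThan)
    have hI: "h i \<in> I" if "i < card I" for i
      using h' that by (auto simp: bij_betw_def)
    have "(\<Sum>i<card I. \<bar>f ((r \<circ> h) i) - f ((l \<circ> h) i)\<bar>) < e"
    proof (rule d)
      show "\<forall>i<card I. \<forall>j<card I. i \<noteq> j \<longrightarrow>
              {(l \<circ> h) i<..<(r \<circ> h) i} \<inter> {(l \<circ> h) j<..<(r \<circ> h) j} = {}"
      proof (intro allI impI)
        fix i j assume ij: "i < card I" "j < card I" "i \<noteq> j"
        then have "h i \<noteq> h j"
          using h' by (auto simp: bij_betw_def inj_on_def)
        with ij I show "{(l \<circ> h) i<..<(r \<circ> h) i} \<inter> {(l \<circ> h) j<..<(r \<circ> h) j} = {}"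
          using hI by (simp add: disj_intervals_def disjoint_family_on_def)
      qed
      show "(\<Sum>i<card I. (r \<circ> h) i - (l \<circ> h) i) < d"
        using len sum.reindex_bij_betw[OF h', of "\<lambda>i. r i - l i"] by simp
    qed (use I hI in \<open>auto simp: disj_intervals_def\<close>)
    then show "(\<Sum>i\<in>I. \<bar>f (r i) - f (l i)\<bar>) < e"
      using sum.reindex_bij_betw[OF h', of "\<lambda>i. \<bar>f (r i) - f (l i)\<bar>"] by simp
  qed
qed

lemma abs_continuous_onI:
  assumes "\<And>e. e > 0 \<Longrightarrow> \<exists>d>0. \<forall>(n::nat) l r. disj_intervals p q {..<n} l r \<longrightarrow>
     (\<Sum>i<n. r i - l i) < d \<longrightarrow> (\<Sum>i<n. \<bar>f (r i) - f (l i)\<bar>) < e"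
  shows "abs_continuous_on p q f"
  unfolding abs_continuous_on_def
proof (intro allI impI)
  fix e :: real assume "e > 0"
  from assms[OF this] obtain d where "d > 0" and d: "\<And>(n::nat) l r. disj_intervals p q {..<n} l r \<Longrightarrow>
     (\<Sum>i<n. r i - l i) < d \<Longrightarrow> (\<Sum>i<n. \<bar>f (r i) - f (l i)\<bar>) < e" by blast
  show "\<exists>\<delta>>0. \<forall>(n::nat) l r.
        (\<forall>i<n. p \<le> l i \<and> l i \<le> r i \<and> r i \<le> q) \<longrightarrow>
        (\<forall>i<n. \<forall>j<n. i \<noteq> j \<longrightarrow> {l i<..<r i} \<inter> {l j<..<r j} = {}) \<longrightarrow>
        (\<Sum>i<n. r i - l i) < \<delta> \<longrightarrow> (\<Sum>i<n. \<bar>f (r i) - f (l i)\<bar>) < e"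
    by (intro exI[of _ d] conjI \<open>d > 0\<close> allI impI d)
       (auto simp: disj_intervals_def disjoint_family_on_def)
qed

text \<open>Common source of the closure properties: on a compact interval the increments of sums,
  products and exponentials are dominated by those of their constituents.\<close>

lemma abs_continuous_on_dominated:
  assumes f: "abs_continuous_on p q f" and g: "abs_continuous_on p q g"
    and h: "\<And>x y. x \<in> {p..q} \<Longrightarrow> y \<in> {p..q} \<Longrightarrow> \<bar>h y - h x\<bar> \<le> M * (\<bar>f y - f x\<bar> + \<bar>g y - g x\<bar>)"
  shows "abs_continuous_on p q h"
proof (rule abs_continuous_onI)
  fix e :: real assume "e > 0"
  \<comment> \<open>\<open>M\<close> may fail to be positive, and \<open>e\<close> is divided by the
    constant below.\<close>
  define N where "N = max M 1"
  have "N > 0" "M \<le> N" by (auto simp: N_def)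
  then have eN: "e / (2 * N) > 0" using \<open>e > 0\<close> by simp
  obtain d1 where "d1 > 0" and d1: "\<And>(I :: nat set) l r. disj_intervals p q I l r \<Longrightarrow>
     (\<Sum>i\<in>I. r i - l i) < d1 \<Longrightarrow> (\<Sum>i\<in>I. \<bar>f (r i) - f (l i)\<bar>) < e / (2 * N)"
    using abs_continuous_on_finite[OF f eN, where 'i = nat] by blast
  obtain d2 where "d2 > 0" and d2: "\<And>(I :: nat set) l r. disj_intervals p q I l r \<Longrightarrow>
     (\<Sum>i\<in>I. r i - l i) < d2 \<Longrightarrow> (\<Sum>i\<in>I. \<bar>g (r i) - g (l i)\<bar>) < e / (2 * N)"
    using abs_continuous_on_finite[OF g eN, where 'i = nat] by blast
  have "(\<Sum>i<n. \<bar>h (r i) - h (l i)\<bar>) < e"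
    if I: "disj_intervals p q {..<n} l r" and len: "(\<Sum>i<n. r i - l i) < min d1 d2" for n :: nat and l r
  proof -
    have "(\<Sum>i<n. \<bar>h (r i) - h (l i)\<bar>) \<le> (\<Sum>i<n. N * (\<bar>f (r i) - f (l i)\<bar> + \<bar>g (r i) - g (l i)\<bar>))"
    proof (rule sum_mono)
      fix i assume "i \<in> {..<n}"
      then have "l i \<in> {p..q}" "r i \<in> {p..q}"
        using I by (force simp: disj_intervals_def)+
      from h[OF this] show "\<bar>h (r i) - h (l i)\<bar> \<le> N * (\<bar>f (r i) - f (l i)\<bar> + \<bar>g (r i) - g (l i)\<bar>)"
        by (rule order_trans) (intro mult_right_mono \<open>M \<le> N\<close>, auto)
    qed
    also have "\<dots> = N * ((\<Sum>i<n. \<bar>f (r i) - f (l i)\<bar>) + (\<Sum>i<n. \<bar>g (r i) - g (l i)\<bar>))"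
      by (simp only: sum_distrib_left sum.distrib distrib_left)
    also have "\<dots> < N * (e / (2 * N) + e / (2 * N))"
      using d1[OF I] d2[OF I] len \<open>N > 0\<close> by (intro mult_strict_left_mono add_strict_mono) auto
    also have "\<dots> = e" using \<open>N > 0\<close> by simp
    finally show ?thesis .
  qed
  then show "\<exists>d>0. \<forall>(n::nat) l r. disj_intervals p q {..<n} l r \<longrightarrow>
     (\<Sum>i<n. r i - l i) < d \<longrightarrow> (\<Sum>i<n. \<bar>h (r i) - h (l i)\<bar>) < e"
    using \<open>d1 > 0\<close> \<open>d2 > 0\<close> by (intro exI[of _ "min d1 d2"]) auto
qed

lemma abs_continuous_on_const: "abs_continuous_on p q (\<lambda>_. c)"
  unfolding abs_continuous_on_def by (auto intro!: exI[of _ 1])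

lemma abs_continuous_on_subset:
  assumes "abs_continuous_on p q f" "p \<le> p'" "q' \<le> q"
  shows "abs_continuous_on p' q' f"
proof (rule abs_continuous_onI)
  fix e :: real assume "e > 0"
  obtain d where "d > 0" and d: "\<And>(I :: nat set) l r. disj_intervals p q I l r \<Longrightarrow>
     (\<Sum>i\<in>I. r i - l i) < d \<Longrightarrow> (\<Sum>i\<in>I. \<bar>f (r i) - f (l i)\<bar>) < e"
    using abs_continuous_on_finite[OF assms(1) \<open>e > 0\<close>, where 'i = nat] by blast
  have "disj_intervals p q I l r" if "disj_intervals p' q' I l r" for I :: "nat set" and l r
    using that assms(2,3) by (force simp: disj_intervals_def)
  with d \<open>d > 0\<close> show "\<exists>d>0. \<forall>(n::nat) l r. disj_intervals p' q' {..<n} l r \<longrightarrow>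
     (\<Sum>i<n. r i - l i) < d \<longrightarrow> (\<Sum>i<n. \<bar>f (r i) - f (l i)\<bar>) < e"
    by (intro exI[of _ d]) auto
qed

lemma abs_continuous_on_imp_continuous_on:
  assumes "abs_continuous_on p q f"
  shows "continuous_on {p..q} f"
  unfolding continuous_on_iff
proof (intro ballI allI impI)
  fix x e :: real assume x: "x \<in> {p..q}" and "e > 0"
  obtain d where "d > 0" and d: "\<And>(I :: nat set) l r. disj_intervals p q I l r \<Longrightarrow>
     (\<Sum>i\<in>I. r i - l i) < d \<Longrightarrow> (\<Sum>i\<in>I. \<bar>f (r i) - f (l i)\<bar>) < e"
    using abs_continuous_on_finite[OF assms \<open>e > 0\<close>, where 'i = nat] by blast
  have "dist (f y) (f x) < e" if y: "y \<in> {p..q}" "dist y x < d" for y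
  proof -
    have "(\<Sum>i\<in>{0::nat}. \<bar>f (max x y) - f (min x y)\<bar>) < e"
      by (rule d) (use x y in \<open>auto simp: disj_intervals_def dist_real_def max_def min_def disjoint_family_on_def\<close>)
    then show ?thesis by (auto simp: dist_real_def max_def min_def split: if_splits)
  qed
  with \<open>d > 0\<close> show "\<exists>d>0. \<forall>x'\<in>{p..q}. dist x' x < d \<longrightarrow> dist (f x') (f x) < e" by blast
qed

lemma abs_continuous_on_add:
  assumes "abs_continuous_on p q f" "abs_continuous_on p q g"
  shows "abs_continuous_on p q (\<lambda>x. f x + g x)"
  by (rule abs_continuous_on_dominated[OF assms, of _ 1]) auto

lemma abs_continuous_on_mult:
  assumes "abs_continuous_on p q f" "abs_continuous_on p q g"
  shows "abs_continuous_on p q (\<lambda>x. f x * g x)"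
proof -
  have "bounded (f ` {p..q})" "bounded (g ` {p..q})"
    using assms[THEN abs_continuous_on_imp_continuous_on]
    by (auto intro!: compact_imp_bounded compact_continuous_image)
  then have "bounded (f ` {p..q} \<union> g ` {p..q})" by simp
  then obtain M where M: "\<And>x. x \<in> {p..q} \<Longrightarrow> \<bar>f x\<bar> \<le> M" "\<And>x. x \<in> {p..q} \<Longrightarrow> \<bar>g x\<bar> \<le> M"
    unfolding bounded_real by (metis UnI1 UnI2 imageI)
  show ?thesis
  proof (rule abs_continuous_on_dominated[OF assms])
    fix x y assume xy: "x \<in> {p..q}" "y \<in> {p..q}"
    have "\<bar>f y * g y - f x * g x\<bar> = \<bar>g y * (f y - f x) + f x * (g y - g x)\<bar>"
      by (simp add: algebra_simps)
    also have "\<dots> \<le> \<bar>g y\<bar> * \<bar>f y - f x\<bar> + \<bar>f x\<bar> * \<bar>g y - g x\<bar>"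
      by (metis abs_mult abs_triangle_ineq)
    also have "\<dots> \<le> M * \<bar>f y - f x\<bar> + M * \<bar>g y - g x\<bar>"
      using M xy by (intro add_mono mult_right_mono) auto
    finally show "\<bar>f y * g y - f x * g x\<bar> \<le> M * (\<bar>f y - f x\<bar> + \<bar>g y - g x\<bar>)"
      by (simp add: algebra_simps)
  qed
qed

lemma abs_continuous_on_exp:
  assumes "abs_continuous_on p q f"
  shows "abs_continuous_on p q (\<lambda>x. exp (f x))"
proof -
  have "bounded (f ` {p..q})"
    using assms[THEN abs_continuous_on_imp_continuous_on]
    by (auto intro!: compact_imp_bounded compact_continuous_image)
  then obtain M where M: "\<And>x. x \<in> {p..q} \<Longrightarrow> \<bar>f x\<bar> \<le> M"
    unfolding bounded_real by (metis imageI)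
  have lip: "\<bar>exp b - exp a\<bar> \<le> exp M * \<bar>b - a\<bar>" if "a \<le> b" "b \<le> M" for a b
  proof -
    \<comment> \<open>The tangent of exp at 0, scaled by \<open>exp b\<close>, yields the Lipschitz
      bound.\<close>
    have "exp b * (1 + (a - b)) \<le> exp b * exp (a - b)"
      by (intro mult_left_mono exp_ge_add_one_self) simp
    then have "exp b - exp a \<le> exp b * (b - a)"
      by (simp add: algebra_simps flip: exp_add)
    also have "\<dots> \<le> exp M * (b - a)"
      using that by (intro mult_right_mono) auto
    finally show ?thesis using that by simp
  qed
  show ?thesis
  proof (rule abs_continuous_on_dominated[OF assms abs_continuous_on_const])
    fix x y assume xy: "x \<in> {p..q}" "y \<in> {p..q}"
    show "\<bar>exp (f y) - exp (f x)\<bar> \<le> exp M * (\<bar>f y - f x\<bar> + \<bar>0 - 0\<bar>)"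
      using lip[of "f x" "f y"] lip[of "f y" "f x"] M[OF xy(1)] M[OF xy(2)]
      by (cases "f x \<le> f y") (auto simp: abs_minus_commute)
  qed
qed

section \<open>Absolute continuity of indefinite integrals\<close>

lemma sum_integral_disj_intervals_le:
  fixes g :: "real \<Rightarrow> real"
  assumes I: "disj_intervals p q I l r" and g: "g integrable_on {p..q}" "\<And>x. x \<in> {p..q} \<Longrightarrow> 0 \<le> g x"
  shows "(\<Sum>i\<in>I. integral {l i..r i} g) \<le> integral {p..q} g"
proof -
  have "finite I" using I by (simp add: disj_intervals_def)
  have sub: "{l i..r i} \<subseteq> {p..q}" if "i \<in> I" for i
    using I that by (force simp: disj_intervals_def)
  \<comment> \<open>The closed intervals may share endpoints; on the open ones the summands have
    disjoint supports, and the integrals are unchanged.\<close>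
  let ?g = "\<lambda>i x. if x \<in> {l i<..<r i} then g x else 0"
  have 1: "(?g i has_integral integral {l i..r i} g) {p..q}" if "i \<in> I" for i
  proof -
    have "g integrable_on {l i..r i}"
      using g(1) sub[OF that] by (rule integrable_on_subinterval)
    then have "(g has_integral integral {l i..r i} g) {l i<..<r i}"
      by (simp add: has_integral_Icc_iff_Ioo integrable_integral flip: has_integral_Icc_iff_Ioo)
    moreover have "{l i<..<r i} \<subseteq> {p..q}" using sub[OF that] by force
    ultimately show ?thesis
      by (subst has_integral_restrict) auto
  qed
  have "((\<lambda>x. \<Sum>i\<in>I. ?g i x) has_integral (\<Sum>i\<in>I. integral {l i..r i} g)) {p..q}"
    by (rule has_integral_sum[OF \<open>finite I\<close> 1])
  then show ?thesis
  proof (rule has_integral_le[OF _ integrable_integral[OF g(1)]])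
    fix x assume x: "x \<in> {p..q}"
    show "(\<Sum>i\<in>I. ?g i x) \<le> g x"
    proof (cases "\<exists>i\<in>I. x \<in> {l i<..<r i}")
      case True
      then obtain i where i: "i \<in> I" "x \<in> {l i<..<r i}" by blast
      have "(\<Sum>j\<in>I. ?g j x) = (\<Sum>j\<in>I. if j = i then g x else 0)"
      proof (rule sum.cong)
        fix j assume "j \<in> I"
        then show "?g j x = (if j = i then g x else 0)"
          using i I unfolding disj_intervals_def disjoint_family_on_def by (metis disjoint_iff)
      qed simp
      with \<open>finite I\<close> i show ?thesis by simp
    next
      case False
      then have "(\<Sum>j\<in>I. ?g j x) = 0" by (intro sum.neutral) auto
      with g(2)[OF x] show ?thesis by simp
    qed
  qed
qed

text \<open>Truncating |f| at height \<open>n\<close> leaves a remainder \<open>g\<close> of small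
  integral, by dominated convergence. The truncated part contributes at most \<open>n\<close> times
  the total length, the remainder at most its whole integral.\<close>

lemma abs_continuous_on_integral:
  fixes f :: "real \<Rightarrow> real"
  assumes f: "f absolutely_integrable_on {p..q}"
  shows "abs_continuous_on p q (\<lambda>t. integral {p..t} f)"
proof (rule abs_continuous_onI)
  fix e :: real assume "e > 0"
  let ?m = "\<lambda>n x. min \<bar>f x\<bar> (real n)"
  have af: "(\<lambda>x. \<bar>f x\<bar>) absolutely_integrable_on {p..q}"
    using set_integrable_abs[OF f] by simp
  have am: "?m n absolutely_integrable_on {p..q}" for n
    by (intro absolutely_integrable_min_1 af) auto
  have "(\<lambda>n. integral {p..q} (?m n)) \<longlonglongrightarrow> integral {p..q} (\<lambda>x. \<bar>f x\<bar>)"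
  proof (rule dominated_convergence(2)[where h = "\<lambda>x. \<bar>f x\<bar>"])
    show "(\<lambda>n. ?m n x) \<longlonglongrightarrow> \<bar>f x\<bar>" for x
    proof (rule tendsto_eventually)
      obtain N where "\<bar>f x\<bar> \<le> real N" using real_arch_simple by blast
      then show "\<forall>\<^sub>F n in sequentially. ?m n x = \<bar>f x\<bar>"
        by (intro eventually_sequentiallyI[of N]) (force simp: min_def)
    qed
  qed (use am af in \<open>auto simp: set_lebesgue_integral_eq_integral(1)\<close>)
  then obtain n where n: "\<bar>integral {p..q} (?m n) - integral {p..q} (\<lambda>x. \<bar>f x\<bar>)\<bar> < e / 2"
    using \<open>e > 0\<close> by (fastforce dest: LIMSEQ_D[where r = "e / 2"])
  define g where "g = (\<lambda>x. \<bar>f x\<bar> - ?m n x)"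
  have ig: "g integrable_on {p..q}"
    unfolding g_def using am af by (intro integrable_diff) (auto simp: set_lebesgue_integral_eq_integral(1))
  have g: "integral {p..q} g < e / 2"
  proof -
    have "integral {p..q} g = integral {p..q} (\<lambda>x. \<bar>f x\<bar>) - integral {p..q} (?m n)"
      unfolding g_def using am af by (intro integral_diff) (auto simp: set_lebesgue_integral_eq_integral(1))
    with n show ?thesis by linarith
  qed
  \<comment> \<open>Taking \<open>n + 1\<close> in the denominator covers the case
    \<open>n = 0\<close>.\<close>
  have "(\<Sum>i<k. \<bar>integral {p..r i} f - integral {p..l i} f\<bar>) < e"
    if I: "disj_intervals p q {..<k} l r" and len: "(\<Sum>i<k. r i - l i) < e / (2 * (real n + 1))" for k :: nat and l r
  proof -
    have "\<bar>integral {p..r i} f - integral {p..l i} f\<bar> \<le> integral {l i..r i} g + real n * (r i - l i)"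
      if "i < k" for i
    proof -
      have lr: "p \<le> l i" "l i \<le> r i" "r i \<le> q" using I that by (auto simp: disj_intervals_def)
      have int: "f absolutely_integrable_on {l i..r i}" "f integrable_on {p..r i}"
        using lr f by (auto intro!: absolutely_integrable_on_subinterval[OF f]
          integrable_on_subinterval[OF set_lebesgue_integral_eq_integral(1)[OF f]])
      have igi: "g integrable_on {l i..r i}"
        using lr by (auto intro!: integrable_on_subinterval[OF ig])
      have "integral {p..r i} f - integral {p..l i} f = integral {l i..r i} f"
        using Henstock_Kurzweil_Integration.integral_combine[OF lr(1,2) int(2)] by simp
      also have "\<bar>\<dots>\<bar> \<le> integral {l i..r i} (\<lambda>x. \<bar>f x\<bar>)"
        using int(1) unfolding absolutely_integrable_on_def real_norm_def[symmetric]
        by (intro integral_norm_bound_integral) auto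
      also have "\<dots> \<le> integral {l i..r i} (\<lambda>x. g x + real n)"
        by (intro integral_le integrable_add igi)
           (use int in \<open>auto simp: g_def absolutely_integrable_on_def\<close>)
      also have "\<dots> = integral {l i..r i} g + real n * (r i - l i)"
        using lr by (subst integral_add) (use igi in auto)
      finally show ?thesis .
    qed
    then have "(\<Sum>i<k. \<bar>integral {p..r i} f - integral {p..l i} f\<bar>)
        \<le> (\<Sum>i<k. integral {l i..r i} g + real n * (r i - l i))"
      by (intro sum_mono) auto
    also have "\<dots> = (\<Sum>i<k. integral {l i..r i} g) + real n * (\<Sum>i<k. r i - l i)"
      by (simp add: sum.distrib sum_distrib_left)
    also have "\<dots> \<le> integral {p..q} g + (real n + 1) * (\<Sum>i<k. r i - l i)"
    proof (intro add_mono mult_right_mono sum_integral_disj_intervals_le[OF I ig])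
      show "0 \<le> (\<Sum>i<k. r i - l i)"
        using I by (intro sum_nonneg) (auto simp: disj_intervals_def)
    qed (auto simp: g_def)
    also have "\<dots> < e / 2 + (real n + 1) * (e / (2 * (real n + 1)))"
      by (intro add_strict_mono g mult_strict_left_mono len) auto
    also have "\<dots> = e" by (simp add: field_simps)
    finally show ?thesis .
  qed
  then show "\<exists>d>0. \<forall>(k::nat) l r. disj_intervals p q {..<k} l r \<longrightarrow>
     (\<Sum>i<k. r i - l i) < d \<longrightarrow> (\<Sum>i<k. \<bar>integral {p..r i} f - integral {p..l i} f\<bar>) < e"
    using \<open>e > 0\<close> by (intro exI[of _ "e / (2 * (real n + 1))"]) auto
qed

section \<open>Differentiation almost everywhere\<close>

lemma AE_lebesgue_iff_negligible: "(AE x in lebesgue. P x) \<longleftrightarrow> negligible {x. \<not> P x}"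
proof
  assume "AE x in lebesgue. P x"
  then obtain N where "{x. \<not> P x} \<subseteq> N" "N \<in> null_sets lebesgue"
    by (elim AE_E3) auto
  then show "negligible {x. \<not> P x}"
    by (metis negligible_iff_null_sets negligible_subset)
next
  assume "negligible {x. \<not> P x}"
  then have "AE x in lebesgue. x \<notin> {x. \<not> P x}"
    by (intro AE_not_in) (simp add: negligible_iff_null_sets)
  then show "AE x in lebesgue. P x" by simp
qed

text \<open>On the null set of bad tags absolute continuity takes over: a fine division covers it by
  intervals of small total length.\<close>

lemma abs_continuous_on_zero_derivative:
  fixes f :: "real \<Rightarrow> real"
  assumes ac: "abs_continuous_on p q f" and "p \<le> q"
    and der: "AE t in lebesgue. t \<in> {p..q} \<longrightarrow> (f has_real_derivative 0) (at t within {p..q})"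
  shows "f q = f p"
proof -
  define N where "N = {t. \<not> (t \<in> {p..q} \<longrightarrow> (f has_real_derivative 0) (at t within {p..q}))}"
  have N: "negligible N"
    using der unfolding N_def AE_lebesgue_iff_negligible .
  have bound: "\<bar>f q - f p\<bar> \<le> e * (1 + (q - p))" if "e > 0" for e
  proof -
    obtain \<delta> where "\<delta> > 0" and \<delta>: "\<And>(I :: (real \<times> real set) set) l r. disj_intervals p q I l r \<Longrightarrow>
     (\<Sum>i\<in>I. r i - l i) < \<delta> \<Longrightarrow> (\<Sum>i\<in>I. \<bar>f (r i) - f (l i)\<bar>) < e"
      using abs_continuous_on_finite[OF ac \<open>e > 0\<close>, where 'i = "real \<times> real set"] by blast
    obtain U where U: "open U" "N \<subseteq> U" "U \<in> lmeasurable" "measure lebesgue U < \<delta>"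
    proof (rule sets_lebesgue_outer_open[OF negligible_imp_sets[OF N] \<open>\<delta> > 0\<close>])
      fix T assume T: "open T" "N \<subseteq> T" "T - N \<in> lmeasurable" "emeasure lebesgue (T - N) < ennreal \<delta>"
      have eq: "T = (T - N) \<union> N" using T(2) by blast
      have m: "T \<in> lmeasurable"
        by (subst eq) (intro fmeasurable.Un T(3) negligible_imp_measurable N)
      have "measure lebesgue T \<le> measure lebesgue (T - N) + measure lebesgue N"
        by (subst eq, rule measure_Un_le) (use T(3) N negligible_imp_sets in auto)
      also have "\<dots> < \<delta>"
        using T(3,4) \<open>\<delta> > 0\<close> negligible_imp_measure0[OF N]
        by (simp add: emeasure_eq_measure2 ennreal_less_iff)
      finally show thesis using that[of T] T m by blast
    qed
    have "\<exists>d>0. \<forall>y\<in>{p..q}. \<bar>y - x\<bar> < d \<longrightarrow> \<bar>f y - f x\<bar> \<le> e * \<bar>y - x\<bar>"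
      if "x \<in> {p..q}" "x \<notin> N" for x
    proof -
      have "(f has_derivative (\<lambda>h. 0)) (at x within {p..q})"
        using that by (simp add: N_def has_real_derivative_iff_has_vector_derivative has_vector_derivative_def)
      then show ?thesis
        unfolding has_derivative_within_alt using \<open>e > 0\<close> by (simp add: real_norm_def)
    qed
    then obtain d where d: "\<And>x. x \<in> {p..q} \<Longrightarrow> x \<notin> N \<Longrightarrow> d x > 0"
      "\<And>x y. x \<in> {p..q} \<Longrightarrow> x \<notin> N \<Longrightarrow> y \<in> {p..q} \<Longrightarrow> \<bar>y - x\<bar> < d x \<Longrightarrow> \<bar>f y - f x\<bar> \<le> e * \<bar>y - x\<bar>"
      by metis
    \<comment> \<open>A tag in \<open>N\<close> confines its interval to the small open set
      \<open>U\<close>; any other tag in \<open>{p..q}\<close> confines it to where \<open>f\<close>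
      grows at rate at most \<open>e\<close>. \<open>UNIV\<close> completes the gauge outside
      \<open>{p..q}\<close>.\<close>
    define \<gamma> where "\<gamma> = (\<lambda>x. if x \<in> N then U else if x \<in> {p..q} then ball x (d x) else UNIV)"
    have "gauge \<gamma>"
      using U d(1) by (auto simp: gauge_def \<gamma>_def)
    then obtain D where D: "D tagged_division_of {p..q}" "\<gamma> fine D"
      by (rule fine_division_exists_real)
    note DD = tagged_division_ofD[OF D(1)]
    have K: "{Inf K..Sup K} = K \<and> Inf K \<le> x \<and> x \<le> Sup K \<and> p \<le> Inf K \<and> Sup K \<le> q \<and> K \<subseteq> \<gamma> x \<and> x \<in> {p..q}"
      if xK: "(x, K) \<in> D" for x K
    proof -
      obtain a b where ab: "K = {a..b}" using DD(4)[OF xK] by (auto simp: box_real)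
      with DD(2,3)[OF xK] D(2) xK show ?thesis by (auto simp: fine_def)
    qed
    define D1 where "D1 = {z\<in>D. fst z \<in> N}"
    define l r :: "real \<times> real set \<Rightarrow> real" where "l = (\<lambda>z. Inf (snd z))" and "r = (\<lambda>z. Sup (snd z))"
    have "finite D" "D1 \<subseteq> D" using DD(1) by (auto simp: D1_def)
    have lr: "p \<le> l i \<and> l i \<le> r i \<and> r i \<le> q" if "i \<in> D" for i
    proof -
      obtain x L where "i = (x, L)" by (cases i)
      then show ?thesis using K[of x L] that by (simp add: l_def r_def)
    qed
    have I: "disj_intervals p q D l r"
      unfolding disj_intervals_def disjoint_family_on_def
    proof (intro conjI ballI impI \<open>finite D\<close>)
      fix i j assume ij: "i \<in> D" "j \<in> D" "i \<noteq> j"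
      obtain x K where i: "i = (x, K)" by (cases i)
      obtain y L where j: "j = (y, L)" by (cases j)
      have "interior K = {Inf K<..<Sup K}" "interior L = {Inf L<..<Sup L}"
        using K ij i j by (metis interior_atLeastAtMost_real)+
      then show "{l i<..<r i} \<inter> {l j<..<r j} = {}"
        using DD(5)[of x K y L] ij i j by (simp add: l_def r_def)
    qed (use lr in auto)
    then have I1: "disj_intervals p q D1 l r"
      using \<open>D1 \<subseteq> D\<close> disjoint_family_on_mono[OF \<open>D1 \<subseteq> D\<close>] finite_subset[OF \<open>D1 \<subseteq> D\<close>]
      unfolding disj_intervals_def by (meson subsetD)
    have "(\<Sum>i\<in>D1. r i - l i) = (\<Sum>i\<in>D1. measure lebesgue {l i<..<r i})"
      using I1 by (intro sum.cong) (auto simp: disj_intervals_def)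
    also have "\<dots> = measure lebesgue (\<Union>i\<in>D1. {l i<..<r i})"
      using I1 by (intro measure_finite_Union[symmetric]) (auto simp: disj_intervals_def)
    also have "\<dots> \<le> measure lebesgue U"
    proof (rule measure_mono_fmeasurable)
      show "(\<Union>i\<in>D1. {l i<..<r i}) \<subseteq> U"
      proof (intro UN_least)
        fix i assume i: "i \<in> D1"
        obtain x L where xL: "i = (x, L)" by (cases i)
        have "{l i..r i} = L" "L \<subseteq> U"
          using K[of x L] i xL by (auto simp: D1_def l_def r_def \<gamma>_def)
        then show "{l i<..<r i} \<subseteq> U" by auto
      qed
    qed (use U I1 in \<open>auto simp: disj_intervals_def\<close>)
    finally have 1: "(\<Sum>i\<in>D1. \<bar>f (r i) - f (l i)\<bar>) < e"
      using U(4) by (intro \<delta>[OF I1]) linarith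
    have 2: "\<bar>f (r i) - f (l i)\<bar> \<le> e * (r i - l i)" if "i \<in> D - D1" for i
    proof -
      obtain x L where xL: "i = (x, L)" by (cases i)
      have x: "x \<in> {p..q}" "x \<notin> N" and L: "{l i..r i} = L" "l i \<le> x" "x \<le> r i" "p \<le> l i" "r i \<le> q" "L \<subseteq> ball x (d x)"
        using K[of x L] that xL by (auto simp: D1_def l_def r_def \<gamma>_def)
      have "l i \<in> L" "r i \<in> L" unfolding L(1)[symmetric] using L(2,3) by auto
      with L(6) have "\<bar>l i - x\<bar> < d x" "\<bar>r i - x\<bar> < d x"
        by (auto simp: dist_real_def abs_minus_commute)
      \<comment> \<open>The tag lies between the endpoints, so the bounds on its two sides add up to
        the full length.\<close>
      with d(2)[OF x, of "l i"] d(2)[OF x, of "r i"] L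
      have "\<bar>f (l i) - f x\<bar> \<le> e * (x - l i)" "\<bar>f (r i) - f x\<bar> \<le> e * (r i - x)" by auto
      then show ?thesis by (simp add: algebra_simps)
    qed
    have len: "(\<Sum>i\<in>D. r i - l i) = q - p"
      using additive_tagged_division_1[OF \<open>p \<le> q\<close> D(1), of "\<lambda>x. x"]
      by (simp add: l_def r_def case_prod_unfold)
    have "f q - f p = (\<Sum>i\<in>D. f (r i) - f (l i))"
      using additive_tagged_division_1[OF \<open>p \<le> q\<close> D(1), of f]
      by (simp add: l_def r_def case_prod_unfold)
    then have "\<bar>f q - f p\<bar> \<le> (\<Sum>i\<in>D. \<bar>f (r i) - f (l i)\<bar>)" by simp
    also have "\<dots> = (\<Sum>i\<in>D1. \<bar>f (r i) - f (l i)\<bar>) + (\<Sum>i\<in>D - D1. \<bar>f (r i) - f (l i)\<bar>)"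
      using \<open>finite D\<close> \<open>D1 \<subseteq> D\<close> by (simp add: sum.subset_diff add.commute)
    also have "\<dots> \<le> e + (\<Sum>i\<in>D - D1. e * (r i - l i))"
      by (intro add_mono sum_mono 2) (use 1 in auto)
    also have "\<dots> \<le> e + (\<Sum>i\<in>D. e * (r i - l i))"
      using I \<open>e > 0\<close> \<open>finite D\<close> by (intro add_mono sum_mono2) (auto simp: disj_intervals_def)
    also have "\<dots> = e * (1 + (q - p))"
      unfolding sum_distrib_left[symmetric] len by (simp add: algebra_simps)
    finally show ?thesis .
  qed
  show "f q = f p"
  proof (rule ccontr)
    assume "f q \<noteq> f p"
    \<comment> \<open>With this \<open>e\<close> the bound becomes half of its own left-hand
      side.\<close>
    then have "0 < \<bar>f q - f p\<bar> / (2 * (1 + (q - p)))" using \<open>p \<le> q\<close> by simp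
    from bound[OF this] have "\<bar>f q - f p\<bar> \<le> \<bar>f q - f p\<bar> / (2 * (1 + (q - p))) * (1 + (q - p))" .
    also have "\<dots> = \<bar>f q - f p\<bar> / 2"
      using \<open>p \<le> q\<close> nonzero_mult_divide_mult_cancel_right[of "1 + (q - p)" "\<bar>f q - f p\<bar>" 2] by simp
    finally have "\<bar>f q - f p\<bar> \<le> \<bar>f q - f p\<bar> / 2" .
    with \<open>f q \<noteq> f p\<close> show False by simp
  qed
qed


text \<open>At a point where differentiation fails there are arbitrarily short intervals on which the
  increment of the integral is off by a fixed proportion of their length. Henstock's lemma makes
  the total length of a disjoint family of them small, and by Vitali's theorem such families
  exhaust the bad points.\<close>

lemma AE_has_derivative_integral:
  fixes f :: "real \<Rightarrow> real"
  assumes f: "f integrable_on {p..q}"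
  shows "AE t in lebesgue. t \<in> {p..q} \<longrightarrow>
           ((\<lambda>t. integral {p..t} f) has_real_derivative f t) (at t within {p..q})"
proof -
  define F where "F = (\<lambda>t. integral {p..t} f)"
  \<comment> \<open>Grading the failure by \<open>1 / Suc m\<close> leaves countably many sets to
    treat. The endpoints are excluded here and rejoin later as a null set.\<close>
  define E where "E = (\<lambda>m::nat. {x\<in>{p<..<q}. \<forall>d>0. \<exists>y\<in>{p..q}. y \<noteq> x \<and> \<bar>y - x\<bar> < d \<and>
      \<bar>F y - F x - f x * (y - x)\<bar> > \<bar>y - x\<bar> / Suc m})"
  have F: "F y - F x = integral {x..y} f" if "p \<le> x" "x \<le> y" "y \<le> q" for x y
  proof -
    have "f integrable_on {p..y}" using that by (auto intro!: integrable_on_subinterval[OF f])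
    from Henstock_Kurzweil_Integration.integral_combine[OF that(1,2) this] show ?thesis by (simp add: F_def)
  qed
  have "negligible (E m)" for m
    unfolding negligible_outer_le
  proof (intro allI impI)
    fix e :: real assume "e > 0"
    then have "e / Suc m > 0" by simp
    \<comment> \<open>The length of a bad interval is below \<open>Suc m\<close> times its Henstock
      error, so this tolerance gives total length at most \<open>e\<close>.\<close>
    from Henstock_lemma[OF f[folded box_real(2)] this]
    obtain \<gamma> where \<gamma>: "gauge \<gamma>" and hen: "\<And>P. \<lbrakk>P tagged_partial_division_of (cbox p q); \<gamma> fine P\<rbrakk> \<Longrightarrow>
             (\<Sum>(x,k)\<in>P. norm (measure lborel k *\<^sub>R f x - integral k f)) < e / Suc m"
      by blast
    \<comment> \<open>Vitali's theorem needs balls: the interval between \<open>x\<close> and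
      \<open>y\<close> is the ball about its midpoint. Indexing by the pair retains the tag
      \<open>x\<close>, which is an endpoint.\<close>
    define c where "c = (\<lambda>z::real \<times> real. (fst z + snd z) / 2)"
    define \<rho> where "\<rho> = (\<lambda>z::real \<times> real. \<bar>snd z - fst z\<bar> / 2)"
    define K where "K = {(x, y). x \<in> {p..q} \<and> y \<in> {p..q} \<and> y \<noteq> x \<and> cball (c (x, y)) (\<rho> (x, y)) \<subseteq> \<gamma> x \<and>
      \<bar>F y - F x - f x * (y - x)\<bar> > \<bar>y - x\<bar> / Suc m}"
    have cb: "cball (c (x, y)) (\<rho> (x, y)) = {min x y..max x y}" for x y
      by (auto simp: c_def \<rho>_def cball_eq_atLeastAtMost min_def max_def field_simps)
    obtain C where C: "countable C" "C \<subseteq> K"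
      "pairwise (\<lambda>i j. disjnt (cball (c i) (\<rho> i)) (cball (c j) (\<rho> j))) C"
      "negligible (E m - (\<Union>i \<in> C. cball (c i) (\<rho> i)))"
    proof (rule Vitali_covering_theorem_cballs[of K \<rho> "E m" c])
      show "0 < \<rho> i" if "i \<in> K" for i using that by (auto simp: K_def \<rho>_def)
      show "\<exists>i. i \<in> K \<and> x \<in> cball (c i) (\<rho> i) \<and> \<rho> i < d" if x: "x \<in> E m" and "d > 0" for x d
      proof -
        obtain d' where d': "d' > 0" "ball x d' \<subseteq> \<gamma> x"
          using \<gamma> by (metis gaugeD open_contains_ball)
        have "0 < min d d'" using \<open>d > 0\<close> d'(1) by simp
        then obtain y where y: "y \<in> {p..q}" "y \<noteq> x" "\<bar>y - x\<bar> < min d d'"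
           "\<bar>F y - F x - f x * (y - x)\<bar> > \<bar>y - x\<bar> / Suc m"
          using x unfolding E_def mem_Collect_eq by blast
        have "cball (c (x, y)) (\<rho> (x, y)) \<subseteq> ball x d'"
          unfolding cb using y(3) by (auto simp: dist_real_def)
        then have "(x, y) \<in> K"
          using x y d' by (auto simp: K_def E_def)
        moreover have "x \<in> cball (c (x, y)) (\<rho> (x, y))" unfolding cb by auto
        moreover have "\<rho> (x, y) < d" using y by (auto simp: \<rho>_def)
        ultimately show ?thesis by blast
      qed
    qed blast
    \<comment> \<open>Henstock's lemma handles finite families; the uniform bound then passes to the
      countable union.\<close>
    have fin: "measure lebesgue (\<Union>i\<in>I. cball (c i) (\<rho> i)) \<le> e" if I: "I \<subseteq> C" "finite I" for I
    proof -
      define P where "P = (\<lambda>z. (fst z, cball (c z) (\<rho> z))) ` I"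
      have inj: "inj_on (\<lambda>z. (fst z, cball (c z) (\<rho> z))) I"
      proof (rule inj_onI)
        fix z w assume "z \<in> I" "w \<in> I" "(fst z, cball (c z) (\<rho> z)) = (fst w, cball (c w) (\<rho> w))"
        \<comment> \<open>The balls are nonempty, so disjointness forces equal balls to have equal
          indices.\<close>
        moreover have "c z \<in> cball (c z) (\<rho> z)" by (auto simp: \<rho>_def)
        ultimately show "z = w" using C(3) I(1)
          unfolding pairwise_def disjnt_def by blast
      qed
      have 1: "P tagged_partial_division_of (cbox p q)"
        unfolding tagged_partial_division_of_def
      proof (intro conjI allI impI)
        fix x L assume "(x, L) \<in> P"
        then obtain y where "(x, y) \<in> I" "L = cball (c (x, y)) (\<rho> (x, y))" by (auto simp: P_def)
        moreover from this have "(x, y) \<in> K" using I C(2) by auto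
        ultimately show "x \<in> L" "L \<subseteq> cbox p q" "\<exists>a b. L = cbox a b"
          unfolding cb by (auto simp: K_def simp flip: box_real(2))
      next
        fix x L y M assume *: "(x, L) \<in> P \<and> (y, M) \<in> P \<and> (x, L) \<noteq> (y, M)"
        then obtain z w where zw: "z \<in> I" "w \<in> I" "(x, L) = (fst z, cball (c z) (\<rho> z))"
          "(y, M) = (fst w, cball (c w) (\<rho> w))"
          by (auto simp: P_def)
        with * have "z \<noteq> w" by auto
        with C(3) I(1) zw have "L \<inter> M = {}"
          unfolding pairwise_def disjnt_def by blast
        then show "interior L \<inter> interior M = {}" using interior_subset by blast
      qed (use I in \<open>simp add: P_def\<close>)
      have 2: "\<gamma> fine P"
        using I C(2) by (force simp: fine_def P_def K_def)
      have "measure lebesgue (\<Union>i\<in>I. cball (c i) (\<rho> i)) \<le> (\<Sum>z\<in>I. measure lebesgue (cball (c z) (\<rho> z)))"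
        by (rule measure_UNION_le[OF \<open>finite I\<close>]) auto
      also have "\<dots> \<le> (\<Sum>z\<in>I. Suc m * norm (measure lborel (cball (c z) (\<rho> z)) *\<^sub>R f (fst z) - integral (cball (c z) (\<rho> z)) f))"
      proof (rule sum_mono)
        fix z assume "z \<in> I"
        then have "z \<in> K" using I C(2) by auto
        obtain x y where z: "z = (x, y)" by (cases z)
        have gt: "\<bar>y - x\<bar> < Suc m * \<bar>F y - F x - f x * (y - x)\<bar>" and xy: "x \<in> {p..q}" "y \<in> {p..q}"
          using \<open>z \<in> K\<close> unfolding K_def z by (auto simp: field_simps)
        have "norm (measure lborel (cball (c z) (\<rho> z)) *\<^sub>R f (fst z) - integral (cball (c z) (\<rho> z)) f)
            = \<bar>F y - F x - f x * (y - x)\<bar>"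
          using F[of x y] F[of y x] xy unfolding z cb by (cases "x \<le> y") (auto simp: min_def max_def algebra_simps)
        moreover have "measure lebesgue (cball (c z) (\<rho> z)) = \<bar>y - x\<bar>"
          unfolding z cb by (cases "x \<le> y") auto
        ultimately show "measure lebesgue (cball (c z) (\<rho> z))
            \<le> Suc m * norm (measure lborel (cball (c z) (\<rho> z)) *\<^sub>R f (fst z) - integral (cball (c z) (\<rho> z)) f)"
          using gt by simp
      qed
      also have "\<dots> = Suc m * (\<Sum>(x,k)\<in>P. norm (measure lborel k *\<^sub>R f x - integral k f))"
        unfolding P_def by (subst sum.reindex[OF inj]) (simp add: sum_distrib_left)
      also have "\<dots> \<le> Suc m * (e / Suc m)"
        using hen[OF 1 2] by (intro mult_left_mono) auto
      also have "\<dots> = e" by simp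
      finally show ?thesis .
    qed
    define V where "V = (\<Union>i \<in> C. cball (c i) (\<rho> i))"
    define T where "T = (E m - V) \<union> V"
    have m1: "V \<in> lmeasurable"
      unfolding V_def by (rule fmeasurable_UN_bound[OF C(1), where B = e]) (use fin in auto)
    have m2: "measure lebesgue V \<le> e"
      unfolding V_def by (rule measure_UN_bound[OF C(1)]) (use fin in auto)
    have n: "negligible (E m - V)" using C(4) by (simp add: V_def)
    have "T \<in> lmeasurable"
      unfolding T_def by (intro fmeasurable.Un negligible_imp_measurable n m1)
    moreover have "measure lebesgue T \<le> e"
    proof -
      have "measure lebesgue T \<le> measure lebesgue (E m - V) + measure lebesgue V"
        unfolding T_def using m1 negligible_imp_sets[OF n] by (intro measure_Un_le) auto
      with m2 negligible_imp_measure0[OF n] show ?thesis by simp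
    qed
    moreover have "E m \<subseteq> T" by (auto simp: T_def)
    ultimately show "\<exists>T. E m \<subseteq> T \<and> T \<in> lmeasurable \<and> measure lebesgue T \<le> e" by blast
  qed
  then have "negligible ((\<Union>m. E m) \<union> {p, q})"
    by (intro negligible_Un negligible_countable_Union) auto
  moreover have "{t. \<not> (t \<in> {p..q} \<longrightarrow> (F has_real_derivative f t) (at t within {p..q}))} \<subseteq> (\<Union>m. E m) \<union> {p, q}"
  proof (rule subsetI, rule ccontr)
    fix x assume x: "x \<in> {t. \<not> (t \<in> {p..q} \<longrightarrow> (F has_real_derivative f t) (at t within {p..q}))}"
      and "x \<notin> (\<Union>m. E m) \<union> {p, q}"
    then have xpq: "x \<in> {p<..<q}" and nE: "\<And>m. x \<notin> E m" by auto
    have "(F has_derivative (\<lambda>h. f x * h)) (at x within {p..q})"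
      unfolding has_derivative_within_alt
    proof (intro conjI allI impI bounded_linear_mult_right)
      fix e :: real assume "e > 0"
      then obtain m where m: "inverse (Suc m) < e" using reals_Archimedean by blast
      from nE[of m] xpq obtain d where "d > 0" and d: "\<And>y. y \<in> {p..q} \<Longrightarrow> y \<noteq> x \<Longrightarrow> \<bar>y - x\<bar> < d \<Longrightarrow>
          \<bar>F y - F x - f x * (y - x)\<bar> \<le> \<bar>y - x\<bar> / Suc m"
        unfolding E_def by force
      have "norm (F y - F x - f x * (y - x)) \<le> e * norm (y - x)" if "y \<in> {p..q}" "norm (y - x) < d" for y
      proof (cases "y = x")
        case False
        have "norm (F y - F x - f x * (y - x)) \<le> inverse (Suc m) * \<bar>y - x\<bar>"
          using d[of y] that False by (simp add: field_simps)
        also have "\<dots> \<le> e * \<bar>y - x\<bar>" using m by (intro mult_right_mono) auto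
        finally show ?thesis by simp
      qed simp
      with \<open>d > 0\<close> show "\<exists>d>0. \<forall>y\<in>{p..q}. norm (y - x) < d \<longrightarrow> norm (F y - F x - f x * (y - x)) \<le> e * norm (y - x)"
        by blast
    qed
    with x show False by (simp add: has_field_derivative_def)
  qed
  ultimately show ?thesis
    unfolding AE_lebesgue_iff_negligible F_def by (rule negligible_subset)
qed

section \<open>Calculus of absolutely continuous primitives\<close>

definition ac_primitive :: "real \<Rightarrow> real \<Rightarrow> (real \<Rightarrow> real) \<Rightarrow> (real \<Rightarrow> real) \<Rightarrow> bool" where
  "ac_primitive p q F f \<longleftrightarrow> abs_continuous_on p q F \<and>
     (AE t in lebesgue. t \<in> {p..q} \<longrightarrow> (F has_real_derivative f t) (at t within {p..q}))"

lemma ac_primitive_const: "ac_primitive p q (\<lambda>_. c) (\<lambda>_. 0)"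
  by (simp add: ac_primitive_def abs_continuous_on_const)

lemma ac_primitive_add:
  assumes "ac_primitive p q F f" "ac_primitive p q G g"
  shows "ac_primitive p q (\<lambda>t. F t + G t) (\<lambda>t. f t + g t)"
  unfolding ac_primitive_def
proof
  show "AE t in lebesgue. t \<in> {p..q} \<longrightarrow> ((\<lambda>t. F t + G t) has_real_derivative f t + g t) (at t within {p..q})"
    using assms[unfolded ac_primitive_def, THEN conjunct2]
    by eventually_elim (auto intro!: DERIV_add)
qed (use assms in \<open>simp add: ac_primitive_def abs_continuous_on_add\<close>)

lemma ac_primitive_mult:
  assumes "ac_primitive p q F f" "ac_primitive p q G g"
  shows "ac_primitive p q (\<lambda>t. F t * G t) (\<lambda>t. f t * G t + F t * g t)"
  unfolding ac_primitive_def
proof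
  show "AE t in lebesgue. t \<in> {p..q} \<longrightarrow>
      ((\<lambda>t. F t * G t) has_real_derivative f t * G t + F t * g t) (at t within {p..q})"
    using assms[unfolded ac_primitive_def, THEN conjunct2]
    by eventually_elim (auto intro!: derivative_eq_intros)
qed (use assms in \<open>simp add: ac_primitive_def abs_continuous_on_mult\<close>)

lemma ac_primitive_cmult:
  assumes "ac_primitive p q F f"
  shows "ac_primitive p q (\<lambda>t. c * F t) (\<lambda>t. c * f t)"
  using ac_primitive_mult[OF ac_primitive_const assms, of c] by simp

lemma ac_primitive_diff:
  assumes "ac_primitive p q F f" "ac_primitive p q G g"
  shows "ac_primitive p q (\<lambda>t. F t - G t) (\<lambda>t. f t - g t)"
  using ac_primitive_add[OF assms(1) ac_primitive_cmult[OF assms(2), of "-1"]] by simp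

lemma ac_primitive_exp:
  assumes "ac_primitive p q F f"
  shows "ac_primitive p q (\<lambda>t. exp (F t)) (\<lambda>t. exp (F t) * f t)"
  unfolding ac_primitive_def
proof
  show "AE t in lebesgue. t \<in> {p..q} \<longrightarrow>
      ((\<lambda>t. exp (F t)) has_real_derivative exp (F t) * f t) (at t within {p..q})"
    using assms[unfolded ac_primitive_def, THEN conjunct2]
    by eventually_elim (auto intro!: derivative_eq_intros)
qed (use assms in \<open>simp add: ac_primitive_def abs_continuous_on_exp\<close>)

lemma ac_primitive_sum:
  assumes "finite I" "\<And>i. i \<in> I \<Longrightarrow> ac_primitive p q (F i) (f i)"
  shows "ac_primitive p q (\<lambda>t. \<Sum>i\<in>I. F i t) (\<lambda>t. \<Sum>i\<in>I. f i t)"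
  using assms by (induction I rule: finite_induct) (auto simp: ac_primitive_const ac_primitive_add)

lemma ac_primitive_cong:
  assumes "ac_primitive p q F f" "\<And>t. t \<in> {p..q} \<Longrightarrow> F t = G t" "\<And>t. t \<in> {p..q} \<Longrightarrow> f t = g t"
  shows "ac_primitive p q G g"
  unfolding ac_primitive_def
proof
  have F: "abs_continuous_on p q F" using assms(1) by (simp add: ac_primitive_def)
  show "abs_continuous_on p q G"
    by (rule abs_continuous_on_dominated[OF F F, of _ 1]) (use assms(2) in auto)
  show "AE t in lebesgue. t \<in> {p..q} \<longrightarrow> (G has_real_derivative g t) (at t within {p..q})"
    using assms(1)[unfolded ac_primitive_def, THEN conjunct2]
    by eventually_elim
       (metis assms(2,3) has_field_derivative_transform_within zero_less_one)
qed

lemma ac_primitive_subset: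
  assumes "ac_primitive p q F f" "p \<le> p'" "q' \<le> q"
  shows "ac_primitive p' q' F f"
  unfolding ac_primitive_def
proof
  show "abs_continuous_on p' q' F"
    using assms by (auto simp: ac_primitive_def intro: abs_continuous_on_subset)
  have "{p'..q'} \<subseteq> {p..q}" using assms by auto
  then show "AE t in lebesgue. t \<in> {p'..q'} \<longrightarrow> (F has_real_derivative f t) (at t within {p'..q'})"
    using assms(1)[unfolded ac_primitive_def, THEN conjunct2]
    by (auto elim!: eventually_mono intro: DERIV_subset)
qed

lemma ac_primitive_imp_continuous_on: "ac_primitive p q F f \<Longrightarrow> continuous_on {p..q} F"
  by (simp add: ac_primitive_def abs_continuous_on_imp_continuous_on)

lemma ac_primitive_unique:
  assumes F: "ac_primitive p q F f" and G: "ac_primitive p q G f" and "F p = G p" and t: "t \<in> {p..q}"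
  shows "F t = G t"
proof -
  \<comment> \<open>The zero-derivative lemma compares the two ends of an interval, hence the
    restriction to \<open>{p..t}\<close>.\<close>
  have "ac_primitive p t (\<lambda>t. F t - G t) (\<lambda>t. f t - f t)"
    using ac_primitive_diff[OF F G] by (rule ac_primitive_subset) (use t in auto)
  then have "F t - G t = F p - G p"
    using t by (intro abs_continuous_on_zero_derivative) (auto simp: ac_primitive_def)
  with \<open>F p = G p\<close> show ?thesis by simp
qed

lemma ac_primitive_integral:
  fixes f :: "real \<Rightarrow> real"
  assumes "f absolutely_integrable_on {p..q}"
  shows "ac_primitive p q (\<lambda>t. integral {p..t} f) f"
  unfolding ac_primitive_def
  using abs_continuous_on_integral[OF assms]
    AE_has_derivative_integral[OF set_lebesgue_integral_eq_integral(1)[OF assms]] by simp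

lemma absolutely_integrable_mult_continuous:
  fixes f g :: "real \<Rightarrow> real"
  assumes f: "f absolutely_integrable_on {p..q}" and g: "continuous_on {p..q} g"
  shows "(\<lambda>t. f t * g t) absolutely_integrable_on {p..q}"
proof -
  have "(\<lambda>t. g t * f t) absolutely_integrable_on {p..q}"
  proof (rule absolutely_integrable_bounded_measurable_product_real[OF _ _ _ f])
    show "g \<in> borel_measurable (lebesgue_on {p..q})"
      by (rule continuous_imp_measurable_on_sets_lebesgue[OF g]) simp
    show "bounded (g ` {p..q})"
      by (intro compact_imp_bounded compact_continuous_image g) simp
  qed simp
  then show ?thesis by (simp add: mult.commute)
qed

lemma linear_ode_unique:
  assumes z: "ac_primitive p q z (\<lambda>t. h t * z t)" and h: "h absolutely_integrable_on {p..q}"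
    and "z p = 0" and t: "t \<in> {p..q}"
  shows "z t = 0"
proof -
  define H where "H = (\<lambda>t. integral {p..t} h)"
  have "ac_primitive p q H h" unfolding H_def by (rule ac_primitive_integral[OF h])
  then have "ac_primitive p q (\<lambda>t. exp (- H t)) (\<lambda>t. exp (- H t) * (- h t))"
    using ac_primitive_exp[OF ac_primitive_cmult[of p q H h "-1"]] by simp
  from ac_primitive_mult[OF this z]
  have "ac_primitive p q (\<lambda>t. exp (- H t) * z t) (\<lambda>_. 0)"
    by (rule ac_primitive_cong) (simp_all add: algebra_simps)
  from ac_primitive_unique[OF this ac_primitive_const[of p q 0] _ t] \<open>z p = 0\<close>
  show ?thesis by simp
qed

section \<open>Iterated integrals\<close>

text \<open>The induction carries only continuity in time: an integrable input times a continuous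
  function is absolutely integrable, and its indefinite integral is again continuous.
  \<open>step\<close> extracts everything else from this.\<close>

lemma upsilon_word_primitive:
  assumes u: "\<And>x. u x absolutely_integrable_on {0..T}" and "0 \<le> T"
  shows "continuous_on {0..T} (\<lambda>t. upsilon_word u t w)"
    and "ac_primitive 0 T (\<lambda>t. upsilon_word u t (w @ [x])) (\<lambda>s. u x s * upsilon_word u s w)"
    and "(\<lambda>s. u x s * upsilon_word u s w) absolutely_integrable_on {0..T}"
    and "t \<in> {0..T} \<Longrightarrow> upsilon_word u t (w @ [x]) = integral {0..t} (\<lambda>s. u x s * upsilon_word u s w)"
proof -
  have step: "(\<lambda>s. u x s * upsilon_word u s w) absolutely_integrable_on {0..T} \<and>
      (\<forall>t\<in>{0..T}. upsilon_word u t (w @ [x]) = integral {0..t} (\<lambda>s. u x s * upsilon_word u s w)) \<and>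
      ac_primitive 0 T (\<lambda>t. upsilon_word u t (w @ [x])) (\<lambda>s. u x s * upsilon_word u s w)"
    if c: "continuous_on {0..T} (\<lambda>t. upsilon_word u t w)" for w x
  proof -
    have int: "(\<lambda>s. u x s * upsilon_word u s w) absolutely_integrable_on {0..T}"
      by (rule absolutely_integrable_mult_continuous[OF u c])
    moreover have eq: "upsilon_word u t (w @ [x]) = integral {0..t} (\<lambda>s. u x s * upsilon_word u s w)"
      if "t \<in> {0..T}" for t
      using set_lebesgue_integral_eq_integral(2)[OF absolutely_integrable_on_subinterval[OF int, of 0 t]] that
      by simp
    moreover have "ac_primitive 0 T (\<lambda>t. upsilon_word u t (w @ [x])) (\<lambda>s. u x s * upsilon_word u s w)"
      by (rule ac_primitive_cong[OF ac_primitive_integral[OF int]]) (use eq in auto)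
    ultimately show ?thesis by blast
  qed
  have c: "continuous_on {0..T} (\<lambda>t. upsilon_word u t w)" for w
  proof (induction w rule: rev_induct)
    case (snoc x w)
    then show ?case using step ac_primitive_imp_continuous_on by blast
  qed simp
  show "continuous_on {0..T} (\<lambda>t. upsilon_word u t w)" by (rule c)
  show "(\<lambda>s. u x s * upsilon_word u s w) absolutely_integrable_on {0..T}"
    "ac_primitive 0 T (\<lambda>t. upsilon_word u t (w @ [x])) (\<lambda>s. u x s * upsilon_word u s w)"
    "t \<in> {0..T} \<Longrightarrow> upsilon_word u t (w @ [x]) = integral {0..t} (\<lambda>s. u x s * upsilon_word u s w)"
    using step[OF c] by auto
qed

lemma upsilon_word_0: "w \<noteq> [] \<Longrightarrow> upsilon_word u 0 w = 0"
proof (cases w rule: rev_cases)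
  case (snoc v x)
  have "AE s in lebesgue. indicat_real {0..0} s *\<^sub>R (u x s * upsilon_word u s v) = 0"
    unfolding AE_lebesgue_iff_negligible
    by (rule negligible_subset[OF negligible_sing[of 0]]) (auto simp: indicator_def)
  then show ?thesis
    unfolding snoc upsilon_word.simps set_lebesgue_integral_def by (rule integral_eq_zero_AE)
qed simp

text \<open>The Lebesgue integral of a non-integrable function is 0 by convention, so the claim
  holds for every nonnegative \<open>u\<close> and every \<open>t\<close>.\<close>

lemma upsilon_word_nonneg:
  assumes "\<And>x s. 0 \<le> u x s"
  shows "0 \<le> upsilon_word u t w"
proof (induction w arbitrary: t rule: rev_induct)
  case (snoc x w)
  then show ?case
    using assms unfolding upsilon_word.simps set_lebesgue_integral_def
    by (intro integral_nonneg_AE always_eventually allI) auto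
qed simp

lemma abs_upsilon_word_le:
  assumes u: "\<And>x. u x absolutely_integrable_on {0..T}" and t: "t \<in> {0..T}"
  shows "\<bar>upsilon_word u t w\<bar> \<le> upsilon_word (\<lambda>x s. \<bar>u x s\<bar>) t w"
  using t
proof (induction w arbitrary: t rule: rev_induct)
  case (snoc x w)
  let ?v = "\<lambda>x s. \<bar>u x s\<bar>"
  have "0 \<le> T" using snoc.prems by auto
  have v: "?v x absolutely_integrable_on {0..T}" for x using set_integrable_abs[OF u] by simp
  have int: "(\<lambda>s. u x s * upsilon_word u s w) integrable_on {0..t}"
    "(\<lambda>s. ?v x s * upsilon_word ?v s w) integrable_on {0..t}"
    using snoc.prems
    by (auto intro!: integrable_on_subinterval[OF set_lebesgue_integral_eq_integral(1)[OF upsilon_word_primitive(3)[OF _ \<open>0 \<le> T\<close>]]] u v)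
  have "\<bar>integral {0..t} (\<lambda>s. u x s * upsilon_word u s w)\<bar> \<le> integral {0..t} (\<lambda>s. ?v x s * upsilon_word ?v s w)"
    unfolding real_norm_def[of "integral _ _", symmetric]
    by (rule integral_norm_bound_integral[OF int])
       (use snoc in \<open>auto simp: abs_mult intro!: mult_left_mono\<close>)
  then show ?case
    unfolding upsilon_word_primitive(4)[OF u \<open>0 \<le> T\<close> snoc.prems]
      upsilon_word_primitive(4)[where u = ?v, OF v \<open>0 \<le> T\<close> snoc.prems] .
qed simp

section \<open>Homogeneous parts of an evaluated series\<close>

definition graded_upsilon :: "('a::finite \<Rightarrow> real \<Rightarrow> real) \<Rightarrow> 'a series \<Rightarrow> nat \<Rightarrow> real \<Rightarrow> real" where
  "graded_upsilon u P k t = (\<Sum>w | length w = k. P w * upsilon_word u t w)"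

lemma finite_words_length: "finite {w :: 'a::finite list. length w = k}"
  using finite_lists_length_eq[of "UNIV :: 'a set" k] by simp

lemma sum_words_Suc:
  fixes f :: "'a::finite list \<Rightarrow> real"
  shows "(\<Sum>w | length w = Suc k. f w) = (\<Sum>x\<in>UNIV. \<Sum>w | length w = k. f (w @ [x]))"
proof -
  have "(\<Sum>x\<in>UNIV. \<Sum>w | length w = k. f (w @ [x])) = (\<Sum>(x, w)\<in>UNIV \<times> {w. length w = k}. f (w @ [x]))"
    by (simp add: sum.cartesian_product)
  also have "\<dots> = (\<Sum>w | length w = Suc k. f w)"
    by (rule sum.reindex_bij_witness[of _ "\<lambda>w. (last w, butlast w)" "\<lambda>(x, w). w @ [x]"])
       (auto intro!: append_butlast_last_id)
  finally show ?thesis by simp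
qed

lemma graded_upsilon_0: "graded_upsilon u P 0 t = P []"
  by (simp add: graded_upsilon_def)

lemma graded_upsilon_Suc_0: "graded_upsilon u P (Suc k) 0 = 0"
  unfolding graded_upsilon_def by (intro sum.neutral) (auto intro!: upsilon_word_0)

text \<open>The last letter of a word names the input of the outermost integration. Sorting the
  words by it leaves the right derivatives in the next lower degree.\<close>

lemma graded_upsilon_Suc:
  fixes u :: "'a::finite \<Rightarrow> real \<Rightarrow> real"
  assumes u: "\<And>x. u x absolutely_integrable_on {0..T}" and "0 \<le> T"
  shows "ac_primitive 0 T (graded_upsilon u P (Suc k)) (\<lambda>s. \<Sum>x\<in>UNIV. u x s * graded_upsilon u (right_deriv x P) k s)"
    and "continuous_on {0..T} (graded_upsilon u P k)"
    and "t \<in> {0..T} \<Longrightarrow> ((\<lambda>s. \<Sum>x\<in>UNIV. u x s * graded_upsilon u (right_deriv x P) k s)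
            has_integral graded_upsilon u P (Suc k) t) {0..t}"
proof -
  let ?g = "\<lambda>s. \<Sum>x\<in>UNIV. u x s * graded_upsilon u (right_deriv x P) k s"
  show c: "continuous_on {0..T} (graded_upsilon u P k)" for P k
    unfolding graded_upsilon_def by (intro continuous_intros upsilon_word_primitive(1) assms)
  have "ac_primitive 0 T (\<lambda>t. \<Sum>x\<in>UNIV. \<Sum>w | length w = k. P (w @ [x]) * upsilon_word u t (w @ [x]))
     (\<lambda>s. \<Sum>x\<in>UNIV. \<Sum>w | length w = k. P (w @ [x]) * (u x s * upsilon_word u s w))"
    by (intro ac_primitive_sum ac_primitive_cmult upsilon_word_primitive assms finite_words_length finite)
  then show prim: "ac_primitive 0 T (graded_upsilon u P (Suc k)) ?g"
    by (rule ac_primitive_cong)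
       (simp_all add: graded_upsilon_def sum_words_Suc right_deriv_def sum_distrib_left mult.left_commute)
  have int: "?g absolutely_integrable_on {0..T}"
    by (intro absolutely_integrable_sum absolutely_integrable_mult_continuous u c finite)
  show "(?g has_integral graded_upsilon u P (Suc k) t) {0..t}" if t: "t \<in> {0..T}"
  proof -
    have "graded_upsilon u P (Suc k) t = integral {0..t} ?g"
      by (rule ac_primitive_unique[OF prim ac_primitive_integral[OF int] _ t])
         (simp add: graded_upsilon_Suc_0)
    moreover have "?g integrable_on {0..t}"
      using t by (auto intro!: integrable_on_subinterval[OF set_lebesgue_integral_eq_integral(1)[OF int]])
    ultimately show ?thesis by (simp add: has_integral_iff)
  qed
qed

lemma graded_upsilon_add:
  "graded_upsilon u (\<lambda>w. P w + Q w) k t = graded_upsilon u P k t + graded_upsilon u Q k t"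
  by (simp add: graded_upsilon_def distrib_right sum.distrib)

lemma graded_upsilon_cmult: "graded_upsilon u (\<lambda>w. c * P w) k t = c * graded_upsilon u P k t"
  by (simp add: graded_upsilon_def sum_distrib_left mult.assoc)

lemma graded_upsilon_one: "graded_upsilon u (of_word []) k t = (if k = 0 then 1 else 0)"
proof (cases k)
  case (Suc j)
  then show ?thesis
    unfolding graded_upsilon_def by (auto simp: of_word_def intro!: sum.neutral)
qed (simp add: graded_upsilon_0 of_word_def)

lemma graded_upsilon_mono:
  assumes "\<And>x s. 0 \<le> u x s" "\<And>w. P w \<le> Q w"
  shows "graded_upsilon u P k t \<le> graded_upsilon u Q k t"
  unfolding graded_upsilon_def
  by (intro sum_mono mult_right_mono upsilon_word_nonneg assms)

lemma graded_upsilon_nonneg: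
  assumes "\<And>x s. 0 \<le> u x s" "\<And>w. 0 \<le> P w"
  shows "0 \<le> graded_upsilon u P k t"
  unfolding graded_upsilon_def
  by (intro sum_nonneg mult_nonneg_nonneg upsilon_word_nonneg assms)

lemma abs_graded_upsilon_le:
  assumes "\<And>x. u x absolutely_integrable_on {0..T}" "t \<in> {0..T}"
  shows "\<bar>graded_upsilon u P k t\<bar> \<le> graded_upsilon (\<lambda>x s. \<bar>u x s\<bar>) (\<lambda>w. \<bar>P w\<bar>) k t"
  unfolding graded_upsilon_def
  by (rule order_trans[OF sum_abs])
     (auto simp: abs_mult intro!: sum_mono mult_left_mono abs_upsilon_word_le[OF assms])

text \<open>In positive degree both sides are absolutely continuous and vanish at 0. The product
  rule on one side and the derivation rule on the other reduce equality of their derivatives to the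
  previous degree.\<close>

lemma graded_upsilon_shuffle:
  fixes u :: "'a::finite \<Rightarrow> real \<Rightarrow> real"
  assumes u: "\<And>x. u x absolutely_integrable_on {0..T}" and "t \<in> {0..T}"
  shows "graded_upsilon u (shuffle P Q) k t = (\<Sum>i\<le>k. graded_upsilon u P i t * graded_upsilon u Q (k - i) t)"
  using assms(2)
proof (induction k arbitrary: P Q t)
  case 0
  show ?case by (simp add: graded_upsilon_0 shuffle_Nil)
next
  case (Suc k)
  then have "0 \<le> T" by auto
  let ?G = "graded_upsilon u"
  \<comment> \<open>The degree 0 part is constant, so \<open>d\<close> is 0 there. This makes the
    product rule uniform in \<open>i\<close> and drops one extreme index from each of the two sums
    below.\<close>
  define d where "d = (\<lambda>P i s. case i of 0 \<Rightarrow> 0 | Suc j \<Rightarrow> \<Sum>x\<in>UNIV. u x s * ?G (right_deriv x P) j s)"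
  have d: "ac_primitive 0 T (?G P i) (d P i)" for P i
  proof (cases i)
    case 0
    then have "?G P i = (\<lambda>_. P [])" "d P i = (\<lambda>_. 0)"
      by (simp_all add: fun_eq_iff graded_upsilon_0 d_def)
    then show ?thesis by (simp add: ac_primitive_const)
  next
    case (Suc j)
    then show ?thesis using graded_upsilon_Suc(1)[OF u \<open>0 \<le> T\<close>, where P = P and k = j] by (simp add: d_def)
  qed
  have "ac_primitive 0 T (\<lambda>t. \<Sum>i\<le>Suc k. ?G P i t * ?G Q (Suc k - i) t)
      (\<lambda>s. \<Sum>i\<le>Suc k. d P i s * ?G Q (Suc k - i) s + ?G P i s * d Q (Suc k - i) s)"
    by (intro ac_primitive_sum ac_primitive_mult d finite_atMost)
  then have "ac_primitive 0 T (\<lambda>t. \<Sum>i\<le>Suc k. ?G P i t * ?G Q (Suc k - i) t) (d (shuffle P Q) (Suc k))"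
  proof (rule ac_primitive_cong)
    fix s assume s: "s \<in> {0..T}"
    have "(\<Sum>i\<le>Suc k. d P i s * ?G Q (Suc k - i) s)
        = (\<Sum>i\<le>k. \<Sum>x\<in>UNIV. u x s * (?G (right_deriv x P) i s * ?G Q (k - i) s))"
      by (subst sum.atMost_Suc_shift) (simp add: d_def sum_distrib_right mult.assoc)
    also have "\<dots> = (\<Sum>x\<in>UNIV. u x s * ?G (shuffle (right_deriv x P) Q) k s)"
      by (subst sum.swap) (simp add: Suc.IH[OF s] sum_distrib_left)
    finally have 1: "(\<Sum>i\<le>Suc k. d P i s * ?G Q (Suc k - i) s)
        = (\<Sum>x\<in>UNIV. u x s * ?G (shuffle (right_deriv x P) Q) k s)" .
    have "(\<Sum>i\<le>Suc k. ?G P i s * d Q (Suc k - i) s)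
        = (\<Sum>i\<le>k. \<Sum>x\<in>UNIV. u x s * (?G P i s * ?G (right_deriv x Q) (k - i) s))"
      by (simp add: d_def sum_distrib_left mult.left_commute Suc_diff_le)
    also have "\<dots> = (\<Sum>x\<in>UNIV. u x s * ?G (shuffle P (right_deriv x Q)) k s)"
      by (subst sum.swap) (simp add: Suc.IH[OF s] sum_distrib_left)
    finally show "(\<Sum>i\<le>Suc k. d P i s * ?G Q (Suc k - i) s + ?G P i s * d Q (Suc k - i) s)
        = d (shuffle P Q) (Suc k) s"
      unfolding sum.distrib 1
      by (simp add: d_def right_deriv_shuffle graded_upsilon_add distrib_left sum.distrib)
  qed simp
  moreover have "(\<Sum>i\<le>Suc k. ?G P i 0 * ?G Q (Suc k - i) 0) = 0"
  proof (intro sum.neutral ballI)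
    fix i show "?G P i 0 * ?G Q (Suc k - i) 0 = 0"
      by (cases i) (simp_all add: graded_upsilon_Suc_0)
  qed
  ultimately show ?case
    using ac_primitive_unique[OF d[of "shuffle P Q" "Suc k"] _ _ Suc.prems]
    by (simp add: graded_upsilon_Suc_0)
qed

section \<open>Majorant and convergence\<close>

lemma sum_words_length_le:
  fixes f :: "'a::finite list \<Rightarrow> real"
  shows "(\<Sum>w | length w \<le> n. f w) = (\<Sum>k\<le>n. \<Sum>w | length w = k. f w)"
proof -
  have "{w :: 'a list. length w \<le> n} = (\<Union>k\<le>n. {w. length w = k})" by auto
  then show ?thesis
    by (simp only:) (rule sum.UNION_disjoint, auto simp: finite_words_length)
qed

lemma finite_words_length_le: "finite {w :: 'a::finite list. length w \<le> n}"
  using finite_lists_length_le[of "UNIV :: 'a set" n] by simp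

lemma UNIV_letter: "(UNIV :: letter set) = {A, B, C}"
  using letter.exhaust by auto

instance letter :: finite
  by standard (simp add: UNIV_letter)

lemma sum_letter: "(\<Sum>x\<in>UNIV. f x) = f A + f B + f C" for f :: "letter \<Rightarrow> real"
  by (simp add: UNIV_letter)

text \<open>The left side runs over the triangle i + j \<le> n inside the square of all pairs up to
  n.\<close>

lemma sum_Cauchy_le_square:
  fixes b :: "nat \<Rightarrow> real"
  assumes "\<And>i. 0 \<le> b i"
  shows "(\<Sum>k\<le>n. \<Sum>i\<le>k. b i * b (k - i)) \<le> (\<Sum>k\<le>n. b k)\<^sup>2"
proof -
  have "(\<Sum>k\<le>n. \<Sum>i\<le>k. b i * b (k - i)) = (\<Sum>(i, j) | i + j \<le> n. b i * b j)"
    by (rule sum.triangle_reindex_eq[symmetric])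
  also have "\<dots> \<le> (\<Sum>(i, j)\<in>{..n} \<times> {..n}. b i * b j)"
    by (rule sum_mono2) (auto simp: assms)
  also have "\<dots> = (\<Sum>k\<le>n. b k)\<^sup>2"
    by (simp add: power2_eq_square sum_product sum.cartesian_product)
  finally show ?thesis .
qed

text \<open>On a time interval that is short in the sense of the integral bound below, the partial sums
  \<open>y\<close> of the majorant series satisfy \<open>y\<^sub>n\<^sub>+\<^sub>1 \<le> \<integral> \<bar>u\<^sub>a\<bar> + 2 \<bar>u\<^sub>b\<bar> y\<^sub>n + \<bar>u\<^sub>c\<bar> y\<^sub>n\<^sup>2\<close>, so that the bound 1 is
  preserved and no estimate of the coefficients is needed.\<close>

lemma majorant_le_1:
  fixes u :: "letter \<Rightarrow> real \<Rightarrow> real"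
  assumes u: "\<And>x. u x absolutely_integrable_on {0..\<tau>}" and t: "t \<in> {0..\<tau>}"
    and small: "integral {0..\<tau>} (\<lambda>s. \<bar>u A s\<bar> + 2 * \<bar>u B s\<bar> + \<bar>u C s\<bar>) \<le> 1"
  shows "(\<Sum>k\<le>n. graded_upsilon (\<lambda>x s. \<bar>u x s\<bar>) (\<lambda>w. \<bar>X_a w\<bar>) k t) \<le> 1"
  using t
proof (induction n arbitrary: t)
  case 0
  show ?case by (simp add: graded_upsilon_0 X_a_Nil)
next
  case (Suc n)
  define v where "v = (\<lambda>x s. \<bar>u x s\<bar>)"
  define Y where "Y = (\<lambda>w. \<bar>X_a w\<bar>)"
  define g where "g = (\<lambda>s. \<bar>u A s\<bar> + 2 * \<bar>u B s\<bar> + \<bar>u C s\<bar>)"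
  let ?N = "\<lambda>s. \<Sum>k\<le>n. graded_upsilon v Y k s"
  have IH: "?N s \<le> 1" if "s \<in> {0..\<tau>}" for s
    using Suc.IH[OF that] by (simp add: v_def Y_def)
  have v: "v x absolutely_integrable_on {0..\<tau>}" for x
    unfolding v_def using set_integrable_abs[OF u] by simp
  have v0: "0 \<le> v x s" for x s by (simp add: v_def)
  have Y0: "0 \<le> graded_upsilon v Y k s" for k s
    by (rule graded_upsilon_nonneg[OF v0]) (simp add: Y_def)
  have "0 \<le> \<tau>" using Suc.prems by auto
  have g: "g integrable_on {0..\<tau>}"
    using v unfolding g_def v_def by (intro integrable_add integrable_on_cmult_right) (auto dest: set_lebesgue_integral_eq_integral(1))
  have "((\<lambda>s. \<Sum>k\<le>n. \<Sum>x\<in>UNIV. v x s * graded_upsilon v (right_deriv x Y) k s)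
      has_integral (\<Sum>k\<le>n. graded_upsilon v Y (Suc k) t)) {0..t}"
    by (intro has_integral_sum graded_upsilon_Suc(3)[where T = \<tau>] v \<open>0 \<le> \<tau>\<close> Suc.prems finite_atMost)
  then have "(\<Sum>k\<le>n. graded_upsilon v Y (Suc k) t) \<le> integral {0..t} g"
  proof (rule has_integral_le)
    show "(g has_integral integral {0..t} g) {0..t}"
      using Suc.prems by (auto intro!: integrable_integral integrable_on_subinterval[OF g])
    fix s assume "s \<in> {0..t}"
    then have s: "s \<in> {0..\<tau>}" using Suc.prems by auto
    have A: "(\<Sum>k\<le>n. graded_upsilon v (right_deriv A Y) k s) = 1"
    proof -
      have "right_deriv A Y = of_word []"
        using right_deriv_X_a(1) by (auto simp: right_deriv_def Y_def fun_eq_iff of_word_def)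
      then show ?thesis by (simp add: graded_upsilon_one)
    qed
    have B: "(\<Sum>k\<le>n. graded_upsilon v (right_deriv B Y) k s) \<le> 2"
    proof -
      have "right_deriv B Y = (\<lambda>w. 2 * Y w)"
        using right_deriv_X_a(2) by (auto simp: right_deriv_def Y_def fun_eq_iff abs_mult)
      then show ?thesis using IH[OF s] by (simp add: graded_upsilon_cmult flip: sum_distrib_left)
    qed
    \<comment> \<open>The absolute value of the shuffle square may be smaller than the shuffle
      square of the absolute values, so for \<open>C\<close> there is only an inequality.\<close>
    have C: "(\<Sum>k\<le>n. graded_upsilon v (right_deriv C Y) k s) \<le> 1"
    proof -
      have "right_deriv C Y w \<le> shuffle Y Y w" for w
        using fun_cong[OF right_deriv_X_a(3), of w] abs_shuffle_le[of X_a X_a w]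
        by (simp add: right_deriv_def Y_def)
      then have "graded_upsilon v (right_deriv C Y) k s \<le> graded_upsilon v (shuffle Y Y) k s" for k
        by (intro graded_upsilon_mono v0)
      moreover have sh: "graded_upsilon v (shuffle Y Y) k s
          = (\<Sum>i\<le>k. graded_upsilon v Y i s * graded_upsilon v Y (k - i) s)" for k
        by (rule graded_upsilon_shuffle[OF v s])
      ultimately have "(\<Sum>k\<le>n. graded_upsilon v (right_deriv C Y) k s)
          \<le> (\<Sum>k\<le>n. \<Sum>i\<le>k. graded_upsilon v Y i s * graded_upsilon v Y (k - i) s)"
        unfolding sh[symmetric] by (intro sum_mono)
      also have "\<dots> \<le> (?N s)\<^sup>2" by (rule sum_Cauchy_le_square[OF Y0])
      also have "\<dots> \<le> 1"
        using IH[OF s] Y0 by (simp add: power_le_one sum_nonneg)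
      finally show ?thesis .
    qed
    have "(\<Sum>k\<le>n. \<Sum>x\<in>UNIV. v x s * graded_upsilon v (right_deriv x Y) k s)
      = v A s * (\<Sum>k\<le>n. graded_upsilon v (right_deriv A Y) k s)
      + v B s * (\<Sum>k\<le>n. graded_upsilon v (right_deriv B Y) k s)
      + v C s * (\<Sum>k\<le>n. graded_upsilon v (right_deriv C Y) k s)"
      by (simp add: sum_letter sum.distrib sum_distrib_left)
    also have "\<dots> \<le> v A s * 1 + v B s * 2 + v C s * 1"
      by (intro add_mono mult_left_mono v0 B C) (simp add: A)
    finally show "(\<Sum>k\<le>n. \<Sum>x\<in>UNIV. v x s * graded_upsilon v (right_deriv x Y) k s) \<le> g s"
      by (simp add: g_def v_def)
  qed
  also have "\<dots> \<le> integral {0..\<tau>} g"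
    using Suc.prems by (intro integral_subset_le integrable_on_subinterval[OF g] g) (auto simp: g_def)
  also have "\<dots> \<le> 1" using small by (simp add: g_def)
  finally have "(\<Sum>k\<le>n. graded_upsilon v Y (Suc k) t) \<le> 1" .
  \<comment> \<open>\<open>X_a\<close> has no constant term, so the degrees from 1 on make up the
    whole partial sum.\<close>
  then show ?case
    unfolding v_def[symmetric] Y_def[symmetric]
    by (subst sum.atMost_Suc_shift) (simp add: graded_upsilon_0 Y_def X_a_Nil)
qed

text \<open>\<open>upsilon\<close> is an unordered sum over words, the estimates are by degree. Any
  finite set of words has bounded length, so the majorant gives absolute summability; and the sets
  of words of length at most n are cofinal among finite sets, so the sums by degree have the same
  limit.\<close>

lemma X_a_expansion:
  fixes u :: "letter \<Rightarrow> real \<Rightarrow> real"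
  assumes u: "\<And>x. u x absolutely_integrable_on {0..\<tau>}" and t: "t \<in> {0..\<tau>}"
    and small: "integral {0..\<tau>} (\<lambda>s. \<bar>u A s\<bar> + 2 * \<bar>u B s\<bar> + \<bar>u C s\<bar>) \<le> 1"
  shows "upsilon_summable u t X_a"
    and "(\<lambda>k. graded_upsilon u X_a k t) sums Xi_a u t"
    and "summable (\<lambda>k. \<bar>graded_upsilon u X_a k t\<bar>)"
    and "(\<Sum>k\<le>n. \<bar>graded_upsilon u X_a k t\<bar>) \<le> 1"
proof -
  let ?f = "\<lambda>w. X_a w * upsilon_word u t w"
  let ?b = "\<lambda>k. graded_upsilon (\<lambda>x s. \<bar>u x s\<bar>) (\<lambda>w. \<bar>X_a w\<bar>) k t"
  have bound: "(\<Sum>k\<le>n. ?b k) \<le> 1" for n by (rule majorant_le_1[OF u t small])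
  have ab: "\<bar>graded_upsilon u X_a k t\<bar> \<le> ?b k" for k
    by (rule abs_graded_upsilon_le[OF u t])
  have words: "(\<Sum>w | length w \<le> n. \<bar>?f w\<bar>) \<le> 1" for n
  proof -
    have "(\<Sum>w | length w \<le> n. \<bar>?f w\<bar>) \<le> (\<Sum>k\<le>n. ?b k)"
      unfolding sum_words_length_le graded_upsilon_def
      by (intro sum_mono) (auto simp: abs_mult intro!: mult_left_mono abs_upsilon_word_le[OF u t])
    with bound[of n] show ?thesis by linarith
  qed
  have "(\<lambda>w. norm (?f w)) summable_on UNIV"
  proof (rule nonneg_bdd_above_summable_on)
    have "sum (\<lambda>w. norm (?f w)) F \<le> 1" if "finite F" for F
    proof -
      obtain n where n: "\<And>w. w \<in> F \<Longrightarrow> length w \<le> n"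
        using finite_nat_set_iff_bounded_le[of "length ` F"] \<open>finite F\<close> by auto
      have "sum (\<lambda>w. norm (?f w)) F \<le> (\<Sum>w | length w \<le> n. norm (?f w))"
        by (rule sum_mono2[OF finite_words_length_le]) (use n in auto)
      with words[of n] show ?thesis by simp
    qed
    then show "bdd_above (sum (\<lambda>w. norm (?f w)) ` {F. F \<subseteq> UNIV \<and> finite F})"
      by (intro bdd_aboveI[of _ 1]) auto
  qed auto
  then have summ: "?f summable_on UNIV" by (rule abs_summable_summable)
  then show "upsilon_summable u t X_a" by (simp add: upsilon_summable_def)
  have "(?f has_sum Xi_a u t) UNIV"
    using has_sum_infsum[OF summ] by (simp add: Xi_a_def upsilon_def)
  moreover have "filterlim (\<lambda>n. {w :: letter list. length w \<le> n}) (finite_subsets_at_top UNIV) sequentially"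
    unfolding filterlim_def le_filter_def eventually_filtermap
  proof (intro allI impI)
    fix P :: "letter list set \<Rightarrow> bool" assume "eventually P (finite_subsets_at_top UNIV)"
    then obtain F where F: "finite F" "\<And>G. finite G \<Longrightarrow> F \<subseteq> G \<Longrightarrow> P G"
      by (auto simp: eventually_finite_subsets_at_top)
    obtain n where n: "\<And>w. w \<in> F \<Longrightarrow> length w \<le> n"
      using finite_nat_set_iff_bounded_le[of "length ` F"] \<open>finite F\<close> by auto
    show "\<forall>\<^sub>F n in sequentially. P {w. length w \<le> n}"
      by (rule eventually_sequentiallyI[of n], rule F(2)[OF finite_words_length_le]) (use n in force)
  qed
  ultimately have "(\<lambda>n. \<Sum>w | length w \<le> n. ?f w) \<longlonglongrightarrow> Xi_a u t"
    unfolding has_sum_def by (rule filterlim_compose)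
  then show "(\<lambda>k. graded_upsilon u X_a k t) sums Xi_a u t"
    by (simp add: sums_def_le sum_words_length_le graded_upsilon_def)
  show le: "(\<Sum>k\<le>n. \<bar>graded_upsilon u X_a k t\<bar>) \<le> 1" for n
    by (rule order_trans[OF sum_mono bound]) (rule ab)
  show "summable (\<lambda>k. \<bar>graded_upsilon u X_a k t\<bar>)"
  proof (rule summableI_nonneg_bounded)
    fix n show "(\<Sum>k<n. \<bar>graded_upsilon u X_a k t\<bar>) \<le> 1"
      by (rule order_trans[OF sum_mono2 le[of n]]) auto
  qed auto
qed

section \<open>The Riccati equation\<close>

lemma Xi_a_integral_equation:
  fixes u :: "letter \<Rightarrow> real \<Rightarrow> real"
  assumes u: "\<And>x. u x absolutely_integrable_on {0..\<tau>}" and t: "t \<in> {0..\<tau>}"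
    and small: "integral {0..\<tau>} (\<lambda>s. \<bar>u A s\<bar> + 2 * \<bar>u B s\<bar> + \<bar>u C s\<bar>) \<le> 1"
  shows "((\<lambda>s. u A s + 2 * u B s * Xi_a u s - u C s * (Xi_a u s)\<^sup>2) has_integral Xi_a u t) {0..t}"
proof -
  define g where "g = (\<lambda>s. \<bar>u A s\<bar> + 2 * \<bar>u B s\<bar> + \<bar>u C s\<bar>)"
  define a where "a = graded_upsilon u X_a"
  define q where "q = (\<lambda>k s. \<Sum>i\<le>k. a i s * a (k - i) s)"
  \<comment> \<open>The integrand of the partial sum up to degree \<open>Suc n\<close>: the Riccati
    right-hand side with the square replaced by Cauchy products up to degree
    \<open>n\<close>.\<close>
  define h where "h = (\<lambda>n s. u A s + 2 * u B s * (\<Sum>k\<le>n. a k s) - u C s * (\<Sum>k\<le>n. q k s))"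
  note exp = X_a_expansion[OF u _ small, folded a_def]
  have "0 \<le> \<tau>" using t by auto
  have sub: "s \<in> {0..\<tau>}" if "s \<in> {0..t}" for s using that t by auto
  have h: "(h n has_integral (\<Sum>k\<le>Suc n. a k t)) {0..t}" for n
  proof -
    have int: "((\<lambda>s. \<Sum>k\<le>n. \<Sum>x\<in>UNIV. u x s * graded_upsilon u (right_deriv x X_a) k s)
        has_integral (\<Sum>k\<le>n. graded_upsilon u X_a (Suc k) t)) {0..t}"
      by (intro has_integral_sum graded_upsilon_Suc(3)[where T = \<tau>] u \<open>0 \<le> \<tau>\<close> t finite_atMost)
    have eq: "(\<Sum>k\<le>n. graded_upsilon u X_a (Suc k) t) = (\<Sum>k\<le>Suc n. a k t)"
      unfolding a_def by (subst sum.atMost_Suc_shift) (simp add: graded_upsilon_0 X_a_Nil)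
    have "(\<Sum>k\<le>n. \<Sum>x\<in>UNIV. u x s * graded_upsilon u (right_deriv x X_a) k s) = h n s"
      if "s \<in> {0..t}" for s
    proof -
      have C: "graded_upsilon u (\<lambda>w. - shuffle X_a X_a w) k s = - q k s" for k
        using graded_upsilon_cmult[where u = u and c = "-1" and P = "shuffle X_a X_a" and k = k and t = s]
          graded_upsilon_shuffle[where u = u and P = X_a and Q = X_a and k = k, OF u sub[OF that]]
        by (simp add: q_def a_def)
      have "(\<Sum>x\<in>UNIV. u x s * graded_upsilon u (right_deriv x X_a) k s)
          = (if k = 0 then u A s else 0) + 2 * u B s * a k s - u C s * q k s" for k
        by (simp add: sum_letter right_deriv_X_a graded_upsilon_one graded_upsilon_cmult C a_def)
      then show ?thesis
        by (simp add: h_def sum.distrib sum_subtractf flip: sum_distrib_left)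
    qed
    then show ?thesis unfolding eq[symmetric] by (rule has_integral_eq[OF _ int])
  qed
  have lim: "(\<lambda>n. \<Sum>k\<le>n. a k s) \<longlonglongrightarrow> Xi_a u s" if "s \<in> {0..\<tau>}" for s
    using exp(2)[OF that] by (simp add: sums_def_le)
  have limq: "(\<lambda>n. \<Sum>k\<le>n. q k s) \<longlonglongrightarrow> (Xi_a u s)\<^sup>2" if "s \<in> {0..\<tau>}" for s
  proof -
    have abs: "summable (\<lambda>k. norm (a k s))" using exp(3)[OF that] by simp
    have "(\<lambda>k. q k s) sums (Xi_a u s * Xi_a u s)"
      using Cauchy_product_sums[OF abs abs] unfolding q_def sums_unique[OF exp(2)[OF that], symmetric] .
    then show ?thesis by (simp only: sums_def_le power2_eq_square)
  qed
  have "g integrable_on {0..\<tau>}"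
    using set_integrable_abs[OF u] unfolding g_def
    by (intro integrable_add integrable_on_cmult_right) (auto dest: set_lebesgue_integral_eq_integral(1))
  then have g: "g integrable_on {0..t}"
    by (rule integrable_on_subinterval) (use t in auto)
  have bound: "norm (h n s) \<le> g s" if s: "s \<in> {0..t}" for n s
  proof -
    \<comment> \<open>Bounding the sum of absolute values, and not just the partial sum, controls
      the Cauchy products too.\<close>
    have 1: "(\<Sum>k\<le>n. \<bar>a k s\<bar>) \<le> 1" by (rule exp(4)[OF sub[OF s]])
    have 2: "\<bar>\<Sum>k\<le>n. a k s\<bar> \<le> 1" by (rule order_trans[OF sum_abs 1])
    have "\<bar>\<Sum>k\<le>n. q k s\<bar> \<le> (\<Sum>k\<le>n. \<Sum>i\<le>k. \<bar>a i s\<bar> * \<bar>a (k - i) s\<bar>)"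
      unfolding q_def abs_mult[symmetric] by (intro order_trans[OF sum_abs] sum_mono sum_abs)
    also have "\<dots> \<le> (\<Sum>k\<le>n. \<bar>a k s\<bar>)\<^sup>2" by (rule sum_Cauchy_le_square) simp
    also have "\<dots> \<le> 1" using 1 by (simp add: power_le_one sum_nonneg)
    finally have 3: "\<bar>\<Sum>k\<le>n. q k s\<bar> \<le> 1" .
    have "\<bar>h n s\<bar> \<le> \<bar>u A s\<bar> + \<bar>2 * u B s * (\<Sum>k\<le>n. a k s)\<bar> + \<bar>u C s * (\<Sum>k\<le>n. q k s)\<bar>"
      unfolding h_def by linarith
    also have "\<dots> \<le> \<bar>u A s\<bar> + 2 * \<bar>u B s\<bar> * 1 + \<bar>u C s\<bar> * 1"
      unfolding abs_mult by (intro add_mono mult_mono 2 3) auto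
    finally show ?thesis by (simp add: g_def)
  qed
  have conv: "(\<lambda>n. h n s) \<longlonglongrightarrow> u A s + 2 * u B s * Xi_a u s - u C s * (Xi_a u s)\<^sup>2" if "s \<in> {0..t}" for s
    unfolding h_def by (intro tendsto_intros lim limq sub that)
  note dom = dominated_convergence[OF has_integral_integrable[OF h] g bound conv]
  have "(\<lambda>n. \<Sum>k\<le>Suc n. a k t) \<longlonglongrightarrow> integral {0..t} (\<lambda>s. u A s + 2 * u B s * Xi_a u s - u C s * (Xi_a u s)\<^sup>2)"
    using dom(2) by (simp only: integral_unique[OF h])
  moreover have "(\<lambda>n. \<Sum>k\<le>Suc n. a k t) \<longlonglongrightarrow> Xi_a u t"
    using lim[OF t] by (rule LIMSEQ_Suc)
  ultimately have "Xi_a u t = integral {0..t} (\<lambda>s. u A s + 2 * u B s * Xi_a u s - u C s * (Xi_a u s)\<^sup>2)"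
    using LIMSEQ_unique by blast
  with dom(1) show ?thesis by (simp add: has_integral_iff)
qed

lemma caratheodory_solution_iff_ac_primitive:
  "caratheodory_solution F y0 \<tau> y \<longleftrightarrow> y 0 = y0 \<and> ac_primitive 0 \<tau> y (\<lambda>t. F t (y t))"
  by (auto simp: caratheodory_solution_def ac_primitive_def)

theorem theorem2:
  fixes u :: "letter \<Rightarrow> real \<Rightarrow> real" and T :: real
  assumes "0 < T"
    and "\<And>x. u x absolutely_integrable_on {0..T}"
  shows "(\<exists>!S. is_S_a1 S) \<and>
    (\<exists>\<tau>. 0 < \<tau> \<and> \<tau> \<le> T \<and>
      (\<forall>t\<in>{0..\<tau>}. upsilon_summable u t X_a) \<and>
      caratheodory_solution (\<lambda>t y. u A t + 2 * u B t * y - u C t * y\<^sup>2) 0 \<tau> (Xi_a u) \<and>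
      (\<forall>y. caratheodory_solution (\<lambda>t y. u A t + 2 * u B t * y - u C t * y\<^sup>2) 0 \<tau> y
           \<longrightarrow> (\<forall>t\<in>{0..\<tau>}. y t = Xi_a u t)))"
proof -
  define g where "g = (\<lambda>s. \<bar>u A s\<bar> + 2 * \<bar>u B s\<bar> + \<bar>u C s\<bar>)"
  have g: "g integrable_on {0..T}"
    using set_integrable_abs[OF assms(2)] unfolding g_def
    by (intro integrable_add integrable_on_cmult_right) (auto dest: set_lebesgue_integral_eq_integral(1))
  \<comment> \<open>Continuity of the indefinite integral at 0, where it vanishes, provides the
    short interval.\<close>
  obtain d where d: "d > 0" "\<And>t. t \<in> {0..T} \<Longrightarrow> \<bar>t\<bar> < d \<Longrightarrow> \<bar>integral {0..t} g\<bar> < 1"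
    using indefinite_integral_continuous_1[OF g, unfolded continuous_on_iff, rule_format, of 0 1] \<open>0 < T\<close>
    by (auto simp: dist_real_def)
  define \<tau> where "\<tau> = min T (d / 2)"
  have \<tau>: "0 < \<tau>" "\<tau> \<le> T" using \<open>0 < T\<close> d(1) by (auto simp: \<tau>_def)
  have small: "integral {0..\<tau>} (\<lambda>s. \<bar>u A s\<bar> + 2 * \<bar>u B s\<bar> + \<bar>u C s\<bar>) \<le> 1"
  proof -
    have "\<tau> \<in> {0..T}" "\<bar>\<tau>\<bar> < d" using \<tau> d(1) by (auto simp: \<tau>_def)
    from d(2)[OF this] show ?thesis by (simp add: g_def)
  qed
  have u: "u x absolutely_integrable_on {0..\<tau>}" for x
    using \<tau> by (intro absolutely_integrable_on_subinterval[OF assms(2)]) auto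
  let ?F = "\<lambda>t y. u A t + 2 * u B t * y - u C t * y\<^sup>2"
  note eq = Xi_a_integral_equation[OF u _ small]
  have int_eq: "Xi_a u t = integral {0..t} (\<lambda>s. ?F s (Xi_a u s))" if "t \<in> {0..\<tau>}" for t
    using integral_unique[OF eq[OF that]] by simp
  \<comment> \<open>So far \<open>Xi_a u\<close> is a pointwise limit. The integral equation makes
    it continuous; then the right-hand side is absolutely integrable, and its integral is absolutely
    continuous with the required derivative.\<close>
  have cont: "continuous_on {0..\<tau>} (Xi_a u)"
  proof -
    have "continuous_on {0..\<tau>} (\<lambda>t. integral {0..t} (\<lambda>s. ?F s (Xi_a u s)))"
      using \<tau> by (intro indefinite_integral_continuous_1 has_integral_integrable[OF eq]) auto
    then show ?thesis by (rule continuous_on_eq) (simp add: int_eq)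
  qed
  have prim: "ac_primitive 0 \<tau> (Xi_a u) (\<lambda>s. ?F s (Xi_a u s))"
  proof -
    have "(\<lambda>s. u A s + 2 * (u B s * Xi_a u s) - u C s * (Xi_a u s)\<^sup>2) absolutely_integrable_on {0..\<tau>}"
      by (intro set_integral_diff set_integral_add set_integrable_mult_right impI
          absolutely_integrable_mult_continuous u continuous_intros cont)
    then have "ac_primitive 0 \<tau> (\<lambda>t. integral {0..t} (\<lambda>s. ?F s (Xi_a u s))) (\<lambda>s. ?F s (Xi_a u s))"
      by (intro ac_primitive_integral) (simp add: mult.assoc)
    then show ?thesis by (rule ac_primitive_cong) (simp_all add: int_eq)
  qed
  have Xi0: "Xi_a u 0 = 0" using int_eq[of 0] \<tau> by simp
  have unique: "y t = Xi_a u t" if y: "caratheodory_solution ?F 0 \<tau> y" and t: "t \<in> {0..\<tau>}" for y t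
  proof -
    have y0: "y 0 = 0" and yp: "ac_primitive 0 \<tau> y (\<lambda>s. ?F s (y s))"
      using y by (auto simp: caratheodory_solution_iff_ac_primitive)
    \<comment> \<open>The difference of the squares factors as (y + Xi)(y - Xi), so the difference
      of two solutions satisfies a linear equation with this integrable coefficient.\<close>
    let ?h = "\<lambda>s. 2 * u B s - u C s * (y s + Xi_a u s)"
    have "ac_primitive 0 \<tau> (\<lambda>s. y s - Xi_a u s) (\<lambda>s. ?h s * (y s - Xi_a u s))"
      using ac_primitive_diff[OF yp prim]
      by (rule ac_primitive_cong) (simp_all add: algebra_simps power2_eq_square)
    moreover have "?h absolutely_integrable_on {0..\<tau>}"
      by (intro set_integral_diff set_integrable_mult_right impI
          absolutely_integrable_mult_continuous u continuous_intros cont ac_primitive_imp_continuous_on[OF yp])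
    ultimately have "y t - Xi_a u t = 0"
      by (rule linear_ode_unique[OF _ _ _ t]) (simp add: y0 Xi0)
    then show ?thesis by simp
  qed
  have "caratheodory_solution ?F 0 \<tau> (Xi_a u)"
    unfolding caratheodory_solution_iff_ac_primitive using Xi0 prim by (rule conjI)
  then show ?thesis
    by (intro conjI exI[of _ \<tau>] ballI allI impI ex1_S_a1 \<tau> X_a_expansion(1)[OF u _ small] unique)
qed

end
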